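(* Let $n\ge 2$. An element $w\in B_n$ satisfies $|O_{\mathrm{Pop}_T}(w)|=2n-1$ if and only if $w$ is $B$-splittable. In particular, the number of $w\in B_n$ with $|O_{\mathrm{Pop}_T}(w)|=2n-1$ is $2^n-n-1$.
   Context: Write $\bar i$ for $-i$ and $\pm[n]=\{1,\dots,n,\bar1,\dots,\bar n\}$. The hyperoctahedral group $B_n$ is the group of permutations $w$ of $\pm[n]$ with $w(\bar i)=\overline{w(i)}$ for all $i$; permutations are composed right-to-left. Its set of reflections $T$ consists of the elements $(i\ j)(\bar i\ \bar j)$ for $i,j\in\pm[n]$ with $j\notin\{i,\bar i\}$, and $(i\ \bar i)$ for $i\in[n]$. $\ell_T(w)$ is the minimal number of reflections with product $w$, and $u\le_T v$ iff $\ell_T(u)+\ell_T(u^{-1}v)=\ell_T(v)$. Fix $c=(\bar1\ \bar2\ \cdots\ \bar n\ 1\ 2\ \cdots\ n)$ and let $NC(B_n,c)=\{w:e\le_T w\le_T c\}$, a lattice under $\le_T$. Define $\pi_T(w)=\bigvee_{t\in T,\ t\le_T w}t$ (join in $NC(B_n,c)$), $\mathrm{Pop}_T(w)=w\cdot\pi_T(w)^{-1}$, and $O_{\mathrm{Pop}_T}(w)=\{w,\mathrm{Pop}_T(w),\mathrm{Pop}_T^2(w),\dots\}$. Totally order $\pm[n]$ by $\bar1\prec\bar2\prec\cdots\prec\bar n\prec1\prec2\prec\cdots\prec n$. An antiexceedance of $w\in B_n$ is an $i\in\pm[n]$ with $i\prec w^{-1}(i)$. $\mathrm{cyc}(u)$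 is the number of cycles of $u$ of length greater than $1$. $w\in B_n$ is $B$-splittable if it has exactly $2n-2$ antiexceedances and $\mathrm{cyc}(\pi_T(w))=1$. *)

theory Defs
  imports Main
begin

text \<open>The signed set \<open>\<pm>[n]\<close> is modelled as the nonzero integers in [-n,n];
  \<open>\<bar>i\<close> is \<open>-i\<close>. Elements of B_n are maps int \<Rightarrow> int that permute \<open>\<pm>[n]\<close>,
  commute with negation, and fix everything outside \<open>\<pm>[n]\<close>.
  Composition is right-to-left: (u v)(x) = u (v x), i.e. \<open>u \<circ> v\<close>.\<close>

definition pm :: "nat \<Rightarrow> int set" where
  "pm n = {x. x \<noteq> 0 \<and> -int n \<le> x \<and> x \<le> int n}"

definition B :: "nat \<Rightarrow> (int \<Rightarrow> int) set" where
  "B n = {w. bij_betw w (pm n) (pm n) \<and> (\<forall>x. w (-x) = - w x) \<and> (\<forall>x. x \<notin> pm n \<longrightarrow> w x = x)}"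

definition refl2 :: "int \<Rightarrow> int \<Rightarrow> int \<Rightarrow> int" where
  "refl2 i j x = (if x = i then j else if x = j then i
                  else if x = -i then -j else if x = -j then -i else x)"

definition refl1 :: "int \<Rightarrow> int \<Rightarrow> int" where
  "refl1 i x = (if x = i then -i else if x = -i then i else x)"

definition refls :: "nat \<Rightarrow> (int \<Rightarrow> int) set" where
  "refls n = {refl2 i j | i j. i \<in> pm n \<and> j \<in> pm n \<and> j \<noteq> i \<and> j \<noteq> -i}
           \<union> {refl1 i | i. 1 \<le> i \<and> i \<le> int n}"

definition lenT :: "nat \<Rightarrow> (int \<Rightarrow> int) \<Rightarrow> nat" where
  "lenT n w = (LEAST k. \<exists>ts. length ts = k \<and> set ts \<subseteq> refls n \<and> foldr (\<circ>) ts id = w)"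

definition leT :: "nat \<Rightarrow> (int \<Rightarrow> int) \<Rightarrow> (int \<Rightarrow> int) \<Rightarrow> bool" where
  "leT n u v \<longleftrightarrow> lenT n u + lenT n (inv u \<circ> v) = lenT n v"

text \<open>The Coxeter element c = (\<bar>1 \<bar>2 ... \<bar>n 1 2 ... n).\<close>
definition cox :: "nat \<Rightarrow> int \<Rightarrow> int" where
  "cox n x = (if x \<notin> pm n then x
              else if x = -int n then 1
              else if x = int n then -1
              else if x > 0 then x + 1 else x - 1)"

definition NC :: "nat \<Rightarrow> (int \<Rightarrow> int) set" where
  "NC n = {w \<in> B n. leT n id w \<and> leT n w (cox n)}"

definition joinNC :: "nat \<Rightarrow> (int \<Rightarrow> int) set \<Rightarrow> (int \<Rightarrow> int)" where
  "joinNC n S = (THE x. x \<in> NC n \<and> (\<forall>t\<in>S. leT n t x)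
                   \<and> (\<forall>y\<in>NC n. (\<forall>t\<in>S. leT n t y) \<longrightarrow> leT n x y))"

definition piT :: "nat \<Rightarrow> (int \<Rightarrow> int) \<Rightarrow> (int \<Rightarrow> int)" where
  "piT n w = joinNC n {t \<in> refls n. leT n t w}"

definition PopT :: "nat \<Rightarrow> (int \<Rightarrow> int) \<Rightarrow> (int \<Rightarrow> int)" where
  "PopT n w = w \<circ> inv (piT n w)"

definition orbitPop :: "nat \<Rightarrow> (int \<Rightarrow> int) \<Rightarrow> (int \<Rightarrow> int) set" where
  "orbitPop n w = {(PopT n ^^ k) w | k. True}"

text \<open>Position in the total order \<bar>1 \<prec> ... \<prec> \<bar>n \<prec> 1 \<prec> ... \<prec> n.\<close>
definition rk :: "nat \<Rightarrow> int \<Rightarrow> int" where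
  "rk n x = (if x < 0 then -x else int n + x)"

definition antiexc :: "nat \<Rightarrow> (int \<Rightarrow> int) \<Rightarrow> int set" where
  "antiexc n w = {i \<in> pm n. rk n i < rk n (inv w i)}"

definition cyc :: "nat \<Rightarrow> (int \<Rightarrow> int) \<Rightarrow> nat" where
  "cyc n u = card ((\<lambda>x. {(u ^^ k) x | k. True}) ` {x \<in> pm n. u x \<noteq> x})"

definition B_splittable :: "nat \<Rightarrow> (int \<Rightarrow> int) \<Rightarrow> bool" where
  "B_splittable n w \<longleftrightarrow> card (antiexc n w) = 2 * n - 2 \<and> cyc n (piT n w) = 1"

end

(*
Fixed vectors are counted instead of measured: for w in B_n let Fix w be the set of odd functions
from the signed set to the field with three elements that are invariant under w. Multiplying by a
reflection changes |Fix w| by a factor of at most 3, which gives 3^(l_T w) * |Fix w| = 3^n, and u <= v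
holds iff every odd function is a sum of an element of Fix u and one of Fix (u^-1 v) and
Fix v is contained in Fix u. Hence w <= c iff every open arc from a to w a is mapped to itself
by w. So pi_T w runs through each class of the finest noncrossing equivalence relation
containing all pairs (x, w x) in circular order.

Pop lowers the number of antiexceedances by exactly cyc (pi_T w), so an orbit has at most
1 + #antiexceedances elements, with equality iff cyc (pi_T) = 1 all along the orbit. Moreover w has
2n - 2 (or 2n - 1) antiexceedances iff w = (c u)^-1, where u runs once through a symmetric set Z in
circular order and Z is nonempty (or empty). If Z = {i, -i}, then w preserves two half circles and
is not B-splittable. Otherwise u moves every point by less than a half turn; then
pi_T = c for the first n - 1 steps, and from then on every point is at most a half turn behind its
image, which forces every nontrivial class to be centrally symmetric and therefore unique.
*)

theory Submission
  imports Defs "HOL-Library.Numeral_Type" "HOL-Library.Function_Algebras"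
begin

text \<open>The field has to be finite, so that cardinalities can replace dimensions, and of
  characteristic other than 2: in characteristic 2 the exchange of \<open>i\<close> and
  \<open>- i\<close> would fix every odd function. Three elements are the smallest choice and make -
  1 the inverse of 2. The obstacle is that \<open>w\<close> itself need not lie below
  \<open>c\<close>, so the arc criterion does not apply to it. The reflections below
  \<open>w\<close> are therefore caught between two bounds: those exchanging \<open>x\<close> and
  \<open>w x\<close> do lie below \<open>w\<close>, and every reflection below \<open>w\<close>
  exchanges points that are related in each noncrossing relation containing all pairs (x, w x). Both
  bounds lead to the same closure, and this makes its permutation the least upper bound.\<close>

lemma card_subgroup_sum:
  fixes A C :: "'a::ab_group_add set"
  assumes fin: "finite A" "finite C"
    and A: "0 \<in> A" "\<And>x y. x \<in> A \<Longrightarrow> y \<in> A \<Longrightarrow> x - y \<in> A"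
    and C: "0 \<in> C" "\<And>x y. x \<in> C \<Longrightarrow> y \<in> C \<Longrightarrow> x - y \<in> C"
  shows "card A * card C = card ((\<lambda>(a, b). a + b) ` (A \<times> C)) * card (A \<inter> C)"
proof -
  let ?f = "\<lambda>(a, b). a + b :: 'a"
  have Aplus: "x + y \<in> A" if "x \<in> A" "y \<in> A" for x y
    using A(2)[OF that(1) A(2)[OF A(1) that(2)]] by simp
  have Cplus: "x + y \<in> C" if "x \<in> C" "y \<in> C" for x y
    using C(2)[OF that(1) C(2)[OF C(1) that(2)]] by simp
  \<comment> \<open>Shifting an element of \<open>A \<inter> C\<close> from one summand to the other
    runs through the fibre over \<open>s\<close>. For fixed spaces this is the dimension formula for
    sum and intersection, in multiplicative form.\<close>
  have fib: "card {p \<in> A \<times> C. ?f p = s} = card (A \<inter> C)" if "s \<in> ?f ` (A \<times> C)" for s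
  proof -
    from that obtain a b where ab: "a \<in> A" "b \<in> C" "s = a + b" by auto
    have "bij_betw (\<lambda>d. (a + d, b - d)) (A \<inter> C) {p \<in> A \<times> C. ?f p = s}"
    proof (rule bij_betwI')
      show "\<exists>x\<in>A \<inter> C. y = (a + x, b - x)" if "y \<in> {p \<in> A \<times> C. ?f p = s}" for y
      proof -
        obtain p q where y: "y = (p, q)" by fastforce
        with that ab have pq: "p \<in> A" "q \<in> C" "p + q = a + b" by auto
        have "b - q = p - a" using pq(3) by (metis add.commute add_diff_cancel_left' add_diff_eq diff_diff_eq2)
        with A(2)[OF pq(1) ab(1)] C(2)[OF ab(2) pq(2)] have "p - a \<in> A \<inter> C" by auto
        moreover have "y = (a + (p - a), b - (p - a))"
          using \<open>b - q = p - a\<close> y by (metis add.commute diff_add_cancel diff_diff_eq2 add_diff_cancel_left')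
        ultimately show ?thesis by blast
      qed
    qed (use ab Aplus C in auto)
    then show ?thesis by (simp add: bij_betw_same_card)
  qed
  have "card A * card C = card (A \<times> C)" by (simp add: card_cartesian_product)
  also have "\<dots> = (\<Sum>s\<in>?f ` (A \<times> C). card {p \<in> A \<times> C. ?f p = s})"
    using sum.image_gen[of "A \<times> C" "\<lambda>_. 1::nat" ?f] fin by simp
  also have "\<dots> = card (?f ` (A \<times> C)) * card (A \<inter> C)" using fib by simp
  finally show ?thesis .
qed

lemma three_cases: "x = 0 \<or> x = 1 \<or> x = - 1" for x :: 3
proof (cases x)
  case (of_int z)
  then have "z = 0 \<or> z = 1 \<or> z = 2" by auto
  with of_int show ?thesis by auto
qed

text \<open>Characteristic other than 2 enters here. It removes the constant left over when an odd
  function is recovered from its increments along the circle.\<close>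

lemma three_half: "x = - x \<Longrightarrow> x = 0" for x :: 3
  using three_cases[of x] by auto

lemma three_sum: "x + x + x = 0" for x :: 3
  using three_cases[of x] by auto

section \<open>Signed permutations, their inverses and reflections\<close>

lemma B_bij: "w \<in> B n \<Longrightarrow> bij w"
proof -
  assume w: "w \<in> B n"
  have 1: "bij_betw w (pm n) (pm n)" using w by (simp add: B_def)
  have "bij_betw w (- pm n) (- pm n)" using w by (intro bij_betwI') (auto simp: B_def)
  from bij_betw_combine[OF 1 this] show "bij w" by simp
qed

lemma B_pm_iff: "w \<in> B n \<Longrightarrow> w x \<in> pm n \<longleftrightarrow> x \<in> pm n"
  unfolding B_def bij_betw_def by auto

lemma B_minus: "w \<in> B n \<Longrightarrow> w (- x) = - w x"
  by (simp add: B_def)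

lemma B_outside: "w \<in> B n \<Longrightarrow> x \<notin> pm n \<Longrightarrow> w x = x"
  by (simp add: B_def)

lemma B_comp: "u \<in> B n \<Longrightarrow> v \<in> B n \<Longrightarrow> u \<circ> v \<in> B n"
  unfolding B_def by (auto intro: bij_betw_trans)

lemma B_id: "id \<in> B n"
  by (simp add: B_def)

lemma B_inv_apply [simp]: "w \<in> B n \<Longrightarrow> inv w (w x) = x" "w \<in> B n \<Longrightarrow> w (inv w x) = x"
  using B_bij by (auto simp: bij_is_inj bij_is_surj surj_f_inv_f)

lemma B_inv_o [simp]: "w \<in> B n \<Longrightarrow> inv w \<circ> w = id" "w \<in> B n \<Longrightarrow> w \<circ> inv w = id"
  by (auto simp: fun_eq_iff)

lemma B_eq_iff: "w \<in> B n \<Longrightarrow> w x = w y \<longleftrightarrow> x = y"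
  using B_bij bij_is_inj inj_eq by metis

lemma B_I:
  assumes "\<And>x. x \<in> pm n \<Longrightarrow> w x \<in> pm n" "\<And>x. w' (w x) = x" "\<And>x. w (w' x) = x"
    "\<And>x. w (- x) = - w x" "\<And>x. x \<notin> pm n \<Longrightarrow> w x = x"
  shows "w \<in> B n"
proof -
  have "w' x \<in> pm n" if "x \<in> pm n" for x
    using assms(2,3,5) that by metis
  then have "bij_betw w (pm n) (pm n)"
    using assms by (intro bij_betw_byWitness[where f' = w']) auto
  with assms show ?thesis by (simp add: B_def)
qed

lemma pm_minus [simp]: "- x \<in> pm n \<longleftrightarrow> x \<in> pm n"
  by (auto simp: pm_def)

lemma finite_pm [simp]: "finite (pm n)"
  by (rule finite_subset[of _ "{- int n..int n}"]) (auto simp: pm_def)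

lemma B_inv: "w \<in> B n \<Longrightarrow> inv w \<in> B n"
proof (rule B_I[where w' = w])
  assume w: "w \<in> B n"
  show "inv w x \<in> pm n" if "x \<in> pm n" for x using that B_pm_iff[OF w, of "inv w x"] w by simp
  show "inv w (- x) = - inv w x" for x
    using B_eq_iff[OF w, of "inv w (- x)" "- inv w x"] B_minus[OF w, of "inv w x"] w by simp
  show "inv w x = x" if "x \<notin> pm n" for x using B_outside[OF w that] B_inv_apply(1)[OF w, of x] by simp
qed simp_all

lemma B_inv_inv: "w \<in> B n \<Longrightarrow> inv (inv w) = w"
  using B_bij inv_inv_eq by blast

lemma B_inv_comp: "u \<in> B n \<Longrightarrow> v \<in> B n \<Longrightarrow> inv (u \<circ> v) = inv v \<circ> inv u"
  using B_bij o_inv_distrib by blast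

lemma B_funpow: "w \<in> B n \<Longrightarrow> w ^^ k \<in> B n"
  by (induction k) (auto simp: B_id B_comp)

text \<open>The case \<open>j = -i\<close> of \<open>refl2 i j\<close> is the reflection \<open>refl1 i\<close>.\<close>

lemma refls_eq: "refls n = {refl2 i j | i j. i \<in> pm n \<and> j \<in> pm n \<and> i \<noteq> j}"
proof -
  have eq: "refl2 i (- i) = refl1 i" "refl1 (- i) = refl1 i" for i
    by (auto simp: refl2_def refl1_def fun_eq_iff)
  have "refl2 i j \<in> refls n" if "i \<in> pm n" "j \<in> pm n" "i \<noteq> j" for i j
  proof (cases "j = - i")
    case True
    then have "refl2 i j = refl1 \<bar>i\<bar>" using eq by (auto simp: abs_if)
    moreover have "1 \<le> \<bar>i\<bar> \<and> \<bar>i\<bar> \<le> int n" using that by (auto simp: pm_def)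
    ultimately show ?thesis unfolding refls_def by blast
  qed (use that in \<open>auto simp: refls_def\<close>)
  moreover have "\<exists>i j. t = refl2 i j \<and> i \<in> pm n \<and> j \<in> pm n \<and> i \<noteq> j" if "t \<in> refls n" for t
  proof -
    from that consider (two) "\<exists>i j. t = refl2 i j \<and> i \<in> pm n \<and> j \<in> pm n \<and> i \<noteq> j"
      | (one) i where "t = refl1 i" "1 \<le> i" "i \<le> int n" unfolding refls_def by blast
    then show ?thesis
    proof cases
      case one
      then have "t = refl2 i (- i)" "i \<in> pm n" "- i \<in> pm n" "i \<noteq> - i" using eq by (auto simp: pm_def)
      then show ?thesis by blast
    qed
  qed
  ultimately show ?thesis by blast
qed



lemma pm_nz: "i \<in> pm n \<Longrightarrow> i \<noteq> 0"
  by (auto simp: pm_def)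

lemma refl2_refl2 [simp]: "i \<in> pm n \<Longrightarrow> j \<in> pm n \<Longrightarrow> refl2 i j (refl2 i j x) = x"
  by (auto simp: refl2_def pm_def)

lemma refl2_B: "i \<in> pm n \<Longrightarrow> j \<in> pm n \<Longrightarrow> refl2 i j \<in> B n"
proof (rule B_I[where w' = "refl2 i j"])
  show "refl2 i j (- x) = - refl2 i j x" if "i \<in> pm n" "j \<in> pm n" for x
    using that by (auto simp: refl2_def pm_def)
qed (auto simp: refl2_def pm_def)

lemma inv_refl2: "i \<in> pm n \<Longrightarrow> j \<in> pm n \<Longrightarrow> inv (refl2 i j) = refl2 i j"
  by (rule inv_unique_comp) (auto simp: fun_eq_iff)

section \<open>Reflection length by counting fixed functions\<close>

text \<open>A copy of the n-dimensional vector space over the three-element field: the values at 1,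
  ..., n are free coordinates, on which signed permutations act with signs. The value 0 outside
  \<open>pm n\<close> keeps the set finite.\<close>

definition oddf :: "nat \<Rightarrow> (int \<Rightarrow> 3) set" where
  "oddf n = {f. (\<forall>x. f (- x) = - f x) \<and> (\<forall>x. x \<notin> pm n \<longrightarrow> f x = 0)}"

definition fixf :: "nat \<Rightarrow> (int \<Rightarrow> int) \<Rightarrow> (int \<Rightarrow> 3) set" where
  "fixf n w = {f \<in> oddf n. \<forall>x. f (w x) = f x}"

lemma finite_oddf: "finite (oddf n)"
proof (rule finite_subset[OF _ finite_set_of_finite_funs[OF finite_pm[of n] finite[of UNIV], of 0]])
qed (auto simp: oddf_def)

lemma fixf_sub: "fixf n w \<subseteq> oddf n"
  by (auto simp: fixf_def)

lemma finite_fixf [simp]: "finite (fixf n w)"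
  using finite_subset[OF fixf_sub finite_oddf] .

lemma fixf_0 [simp]: "0 \<in> fixf n w"
  by (auto simp: fixf_def oddf_def)

lemma fixf_diff: "f \<in> fixf n w \<Longrightarrow> g \<in> fixf n w \<Longrightarrow> f - g \<in> fixf n w"
  by (auto simp: fixf_def oddf_def)

lemma oddf_diff: "f \<in> oddf n \<Longrightarrow> g \<in> oddf n \<Longrightarrow> f - g \<in> oddf n"
  by (auto simp: oddf_def)

lemma oddf_add: "f \<in> oddf n \<Longrightarrow> g \<in> oddf n \<Longrightarrow> f + g \<in> oddf n"
  by (auto simp: oddf_def)

lemma fixf_id: "fixf n id = oddf n"
  by (auto simp: fixf_def)

lemma card_fixf_pos: "card (fixf n w) > 0"
  by (metis card_gt_0_iff empty_iff finite_fixf fixf_0)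

lemma fixf_inv: "w \<in> B n \<Longrightarrow> fixf n (inv w) = fixf n w"
  unfolding fixf_def by (metis (no_types, lifting) B_inv_apply)

text \<open>For \<open>j = - i\<close> the equation reads \<open>f i = - f i\<close>, hence
  \<open>f i = 0\<close>. One condition thus describes the fixed hyperplane for both kinds of
  reflections.\<close>

lemma oddf_refl2:
  assumes "f \<in> oddf n" "i \<in> pm n" "j \<in> pm n"
  shows "f \<in> fixf n (refl2 i j) \<longleftrightarrow> f i = f j"
proof
  assume "f \<in> fixf n (refl2 i j)"
  then have "f (refl2 i j i) = f i" by (simp add: fixf_def)
  then show "f i = f j" by (simp add: refl2_def)
next
  have odd: "f (- x) = - f x" for x using assms(1) by (simp add: oddf_def)
  assume "f i = f j"
  then show "f \<in> fixf n (refl2 i j)" using assms(1) odd[of i] odd[of j]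
    by (auto simp: fixf_def refl2_def)
qed

text \<open>The functional \<open>f i - f j\<close> takes at most three values. Subtracting one
  member of a nonempty fibre embeds that fibre into the kernel, which consists of the functions also
  fixed by the reflection.\<close>

lemma card_fixf_le:
  assumes "i \<in> pm n" "j \<in> pm n"
  shows "card (fixf n w) \<le> 3 * card (fixf n w \<inter> fixf n (refl2 i j))"
proof -
  let ?A = "fixf n w" and ?K = "fixf n w \<inter> fixf n (refl2 i j)"
  let ?F = "\<lambda>s. {f \<in> ?A. f i - f j = s}"
  have K: "?K = ?F 0"
    using oddf_refl2[OF _ assms] fixf_sub by fastforce
  have fib: "card (?F s) \<le> card ?K" for s
  proof (cases "?F s = {}")
    case False
    then obtain f where f: "f \<in> ?A" "f i - f j = s" by auto
    have "(\<lambda>g. g - f) ` ?F s \<subseteq> ?K"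
      unfolding K using f fixf_diff by (auto simp: algebra_simps)
    moreover have "inj_on (\<lambda>g. g - f) (?F s)" by (auto simp: inj_on_def)
    ultimately show ?thesis by (intro card_inj_on_le) auto
  qed (metis card.empty le0)
  have "?A = (\<Union>s\<in>UNIV. ?F s)" by auto
  then have "card ?A = card (\<Union>s\<in>UNIV. ?F s)" by (rule arg_cong)
  also have "\<dots> \<le> (\<Sum>s\<in>UNIV. card (?F s))" by (rule card_UN_le) simp
  also have "\<dots> \<le> (\<Sum>s\<in>(UNIV::3 set). card ?K)" by (rule sum_mono) (rule fib)
  finally show ?thesis by simp
qed

definition delta :: "int \<Rightarrow> int \<Rightarrow> 3" where
  "delta a x = (if x = a then 1 else 0) - (if x = - a then 1 else 0)"

lemma delta_oddf: "a \<in> pm n \<Longrightarrow> delta a \<in> oddf n"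
  by (auto simp: delta_def oddf_def pm_def)

text \<open>The product fixes \<open>x\<close> and still fixes every function that \<open>w\<close>
  fixes, so multiples of \<open>delta x\<close> may be added freely. The multiple can be read off
  the result, because functions fixed by \<open>w\<close> agree at \<open>x\<close> and
  \<open>w x\<close> while \<open>delta x\<close> does not.\<close>

lemma card_fixf_step_ge:
  assumes w: "w \<in> B n" and x: "x \<in> pm n" "w x \<noteq> x"
  shows "3 * card (fixf n w) \<le> card (fixf n (refl2 x (w x) \<circ> w))"
proof -
  let ?t = "refl2 x (w x)" and ?w' = "refl2 x (w x) \<circ> w"
  have wx: "w x \<in> pm n" using B_pm_iff w x by blast
  have fx: "?w' x = x" using x by (simp add: refl2_def)
  have fmx: "?w' (- x) = - x" using x w fx B_minus[OF B_comp[OF refl2_B[OF x(1) wx] w]] by simp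
  have inj: "?w' y = ?w' z \<longleftrightarrow> y = z" for y z
    using B_eq_iff[OF B_comp[OF refl2_B[OF x(1) wx] w]] .
  let ?h = "\<lambda>(f, a) y. f y + a * delta x y"
  have dfix: "delta x (?w' y) = delta x y" for y
  proof -
    have "?w' y = x \<longleftrightarrow> y = x" using inj[of y x] unfolding fx .
    moreover have "?w' y = - x \<longleftrightarrow> y = - x" using inj[of y "- x"] unfolding fmx .
    ultimately show ?thesis by (simp only: delta_def)
  qed
  have sub: "f \<in> fixf n ?w'" if f: "f \<in> fixf n w" for f
  proof -
    have o: "f \<in> oddf n" and "f x = f (w x)" using f by (auto simp: fixf_def)
    then have "f \<in> fixf n ?t" using oddf_refl2[OF o x(1) wx] by simp
    with f show ?thesis by (simp add: fixf_def)
  qed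
  have "inj_on ?h (fixf n w \<times> UNIV)"
  proof (rule inj_onI, clarsimp simp: fun_eq_iff)
    fix f a g b
    assume f: "f \<in> fixf n w" and g: "g \<in> fixf n w"
      and eq: "\<forall>y. f y + a * delta x y = g y + b * delta x y"
    have 1: "f x + a * delta x x = g x + b * delta x x"
      and 2: "f x + a * delta x (w x) = g x + b * delta x (w x)"
      using spec[OF eq, of x] spec[OF eq, of "w x"] f g by (simp_all add: fixf_def)
    have "(a - b) * (delta x x - delta x (w x)) = 0"
    proof -
      have "(a - b) * (delta x x - delta x (w x))
          = (f x + a * delta x x) - (f x + a * delta x (w x))
            - ((g x + b * delta x x) - (g x + b * delta x (w x)))"
        by (simp add: algebra_simps)
      then show ?thesis unfolding 1 2 by simp
    qed
    \<comment> \<open>The difference is 1 unless \<open>w x = - x\<close>, when it is 1 + 1 = -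
      1.\<close>
    moreover have "delta x x - delta x (w x) = 1 \<or> delta x x - delta x (w x) = -1"
      using x pm_nz[OF x(1)] by (auto simp: delta_def)
    ultimately have "a = b" by auto
    with eq show "(\<forall>y. f y = g y) \<and> a = b" by simp
  qed
  moreover have "?h ` (fixf n w \<times> UNIV) \<subseteq> fixf n ?w'"
    using sub dfix delta_oddf[OF x(1)] by (auto simp: fixf_def oddf_def)
  ultimately have "card (fixf n w \<times> (UNIV :: 3 set)) \<le> card (fixf n ?w')"
    by (intro card_inj_on_le) auto
  then show ?thesis by (simp add: card_cartesian_product)
qed

lemma card_fixf_prod:
  assumes "set ts \<subseteq> refls n"
  shows "card (oddf n) \<le> 3 ^ length ts * card (fixf n (foldr (\<circ>) ts id))"
  using assms
proof (induction ts)
  case (Cons t ts)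
  then obtain i j where t: "t = refl2 i j" "i \<in> pm n" "j \<in> pm n" by (auto simp: refls_eq)
  let ?w = "foldr (\<circ>) ts id"
  have "fixf n ?w \<inter> fixf n t \<subseteq> fixf n (t \<circ> ?w)" by (auto simp: fixf_def)
  then have "card (fixf n ?w \<inter> fixf n t) \<le> card (fixf n (t \<circ> ?w))" by (intro card_mono) auto
  with card_fixf_le[OF t(2,3), of ?w] have "card (fixf n ?w) \<le> 3 * card (fixf n (t \<circ> ?w))"
    using t by simp
  then have "3 ^ length ts * card (fixf n ?w) \<le> 3 ^ length ts * (3 * card (fixf n (t \<circ> ?w)))"
    by (rule mult_le_mono2)
  also have "\<dots> = 3 ^ length (t # ts) * card (fixf n (foldr (\<circ>) (t # ts) id))" by simp
  finally have "3 ^ length ts * card (fixf n ?w) \<le> 3 ^ length (t # ts) * card (fixf n (foldr (\<circ>) (t # ts) id))" .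
  moreover have "set ts \<subseteq> refls n" using Cons.prems by simp
  then have "card (oddf n) \<le> 3 ^ length ts * card (fixf n ?w)" by (rule Cons.IH)
  ultimately show ?case by (rule order_trans[rotated])
qed (simp add: fixf_id[unfolded id_def] id_def)

text \<open>Greedy: splitting off \<open>refl2 x (w x)\<close> makes \<open>x\<close> a fixed point
  and disturbs no other fixed point, while the number of fixed functions grows at least threefold.
  The length obtained therefore attains the bound of \<open>card_fixf_prod\<close>.\<close>

lemma reflection_factorization:
  assumes "w \<in> B n"
  shows "\<exists>ts. set ts \<subseteq> refls n \<and> foldr (\<circ>) ts id = w
    \<and> 3 ^ length ts * card (fixf n w) \<le> card (oddf n)"
  using assms
proof (induction "card {x \<in> pm n. w x \<noteq> x}" arbitrary: w rule: less_induct)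
  case less
  show ?case
  proof (cases "\<exists>x\<in>pm n. w x \<noteq> x")
    case False
    then have "w = id" using less.prems by (auto simp: fun_eq_iff B_outside)
    then show ?thesis using fixf_id by (intro exI[of _ "[]"]) auto
  next
    case True
    then obtain x where x: "x \<in> pm n" "w x \<noteq> x" by blast
    let ?t = "refl2 x (w x)"
    have wx: "w x \<in> pm n" using B_pm_iff less.prems x by blast
    have tw: "?t \<circ> w \<in> B n" using B_comp refl2_B less.prems x wx by blast
    have "{y \<in> pm n. (?t \<circ> w) y \<noteq> y} \<subset> {y \<in> pm n. w y \<noteq> y}"
    proof (rule psubsetI)
      show "{y \<in> pm n. (?t \<circ> w) y \<noteq> y} \<subseteq> {y \<in> pm n. w y \<noteq> y}"
      proof (clarsimp)
        fix y assume "y \<in> pm n" "?t y \<noteq> y" "w y = y"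
        then have "y = x \<or> y = w x \<or> y = - x \<or> y = - w x" by (auto simp: refl2_def split: if_splits)
        with x \<open>w y = y\<close> show False using B_eq_iff[OF less.prems] B_minus[OF less.prems]
          by (metis minus_equation_iff)
      qed
      have "x \<notin> {y \<in> pm n. (?t \<circ> w) y \<noteq> y}" using x by (simp add: refl2_def)
      then show "{y \<in> pm n. (?t \<circ> w) y \<noteq> y} \<noteq> {y \<in> pm n. w y \<noteq> y}" using x by blast
    qed
    then have "card {y \<in> pm n. (?t \<circ> w) y \<noteq> y} < card {y \<in> pm n. w y \<noteq> y}"
      by (intro psubset_card_mono) auto
    from less.hyps[OF this tw] obtain ts where ts: "set ts \<subseteq> refls n" "foldr (\<circ>) ts id = ?t \<circ> w"
      "3 ^ length ts * card (fixf n (?t \<circ> w)) \<le> card (oddf n)" by blast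
    have "foldr (\<circ>) (?t # ts) id = ?t \<circ> ?t \<circ> w" by (simp only: foldr.simps comp_apply ts(2) o_assoc)
    also have "?t \<circ> ?t = id" using x wx by (simp add: fun_eq_iff)
    finally have "foldr (\<circ>) (?t # ts) id = w" unfolding id_comp .
    moreover have "?t \<in> refls n" unfolding refls_eq using x wx by (blast dest: not_sym)
    moreover have "3 ^ length (?t # ts) * card (fixf n w) \<le> card (oddf n)"
    proof -
      have "3 ^ length (?t # ts) * card (fixf n w) = 3 ^ length ts * (3 * card (fixf n w))" by simp
      also have "\<dots> \<le> 3 ^ length ts * card (fixf n (?t \<circ> w))"
        using card_fixf_step_ge[OF less.prems x] by (rule mult_le_mono2)
      finally show ?thesis using ts(3) by (rule order_trans)
    qed
    ultimately show ?thesis using ts(1) by (intro exI[of _ "?t # ts"]) auto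
  qed
qed

lemma lenT_card:
  assumes "w \<in> B n"
  shows "3 ^ lenT n w * card (fixf n w) = card (oddf n)"
proof -
  let ?P = "\<lambda>k. \<exists>ts. length ts = k \<and> set ts \<subseteq> refls n \<and> foldr (\<circ>) ts id = w"
  obtain ts where ts: "set ts \<subseteq> refls n" "foldr (\<circ>) ts id = w"
    "3 ^ length ts * card (fixf n w) \<le> card (oddf n)"
    using reflection_factorization[OF assms] by blast
  then have P: "?P (length ts)" by blast
  have "lenT n w \<le> length ts" unfolding lenT_def using P by (rule Least_le)
  then have "3 ^ lenT n w * card (fixf n w) \<le> 3 ^ length ts * card (fixf n w)"
    by (intro mult_le_mono1 power_increasing) auto
  moreover have "?P (lenT n w)" unfolding lenT_def using P by (rule LeastI)
  then obtain us where us: "length us = lenT n w" "set us \<subseteq> refls n" "foldr (\<circ>) us id = w" by blast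
  then have "card (oddf n) \<le> 3 ^ lenT n w * card (fixf n w)"
    using card_fixf_prod[OF us(2)] unfolding us(1,3) by simp
  ultimately show ?thesis using ts(3) by linarith
qed

lemma lenT_eq_0: "w \<in> B n \<Longrightarrow> lenT n w = 0 \<longleftrightarrow> w = id"
proof
  assume w: "w \<in> B n" "lenT n w = 0"
  show "w = id"
  proof (rule ccontr)
    assume "w \<noteq> id"
    then obtain x where x: "x \<in> pm n" "w x \<noteq> x" using B_outside w(1) by (metis eq_id_iff)
    have "3 * card (fixf n w) \<le> card (oddf n)"
      using card_fixf_step_ge[OF w(1) x] card_mono[OF finite_oddf fixf_sub] by (meson le_trans)
    with lenT_card[OF w(1)] w(2) card_fixf_pos[of n w] show False by simp
  qed
next
  assume "w \<in> B n" "w = id"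
  then have "3 ^ lenT n w * card (oddf n) = card (oddf n)" using lenT_card[of w n] fixf_id by metis
  moreover have "card (oddf n) > 0" using card_fixf_pos[of n id] by (simp add: fixf_id)
  ultimately show "lenT n w = 0" by simp
qed

lemma leT_card:
  assumes "u \<in> B n" "v \<in> B n"
  shows "leT n u v \<longleftrightarrow> card (fixf n u) * card (fixf n (inv u \<circ> v)) = card (oddf n) * card (fixf n v)"
proof -
  let ?a = "card (fixf n u)" and ?b = "card (fixf n (inv u \<circ> v))" and ?d = "card (fixf n v)"
  let ?V = "card (oddf n)"
  have 1: "3 ^ lenT n u * ?a = ?V" "3 ^ lenT n v * ?d = ?V" "3 ^ lenT n (inv u \<circ> v) * ?b = ?V"
    using lenT_card B_comp B_inv assms by auto
  have pos: "?a > 0" "?b > 0" "?d > 0" "?V > 0"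
    using card_fixf_pos[of n] card_fixf_pos[of n id] by (simp_all add: fixf_id)
  have A: "3 ^ (lenT n u + lenT n (inv u \<circ> v)) * (?a * ?b) = ?V * ?V"
  proof -
    have "?V * ?V = (3 ^ lenT n u * ?a) * (3 ^ lenT n (inv u \<circ> v) * ?b)" using 1 by simp
    also have "\<dots> = 3 ^ (lenT n u + lenT n (inv u \<circ> v)) * (?a * ?b)"
      by (simp only: power_add ac_simps)
    finally show ?thesis by simp
  qed
  have D: "3 ^ lenT n v * (?V * ?d) = ?V * ?V" using 1(2) by (simp add: mult.left_commute)
  show ?thesis
  proof
    assume "leT n u v"
    then have "3 ^ lenT n v * (?a * ?b) = 3 ^ lenT n v * (?V * ?d)" using A unfolding D leT_def by simp
    then show "?a * ?b = ?V * ?d" by simp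
  next
    assume "?a * ?b = ?V * ?d"
    then have "3 ^ (lenT n u + lenT n (inv u \<circ> v)) * (?a * ?b) = 3 ^ lenT n v * (?a * ?b)"
      using A D unfolding \<open>?a * ?b = ?V * ?d\<close> by (metis (no_types))
    moreover have "?a * ?b \<noteq> 0" using pos by (metis mult_eq_0_iff less_not_refl)
    ultimately have "(3::nat) ^ (lenT n u + lenT n (inv u \<circ> v)) = 3 ^ lenT n v"
      by (metis mult_right_cancel)
    then show "leT n u v" by (simp add: leT_def)
  qed
qed

lemma fixf_Int_sub: "u \<in> B n \<Longrightarrow> fixf n u \<inter> fixf n (inv u \<circ> v) \<subseteq> fixf n v"
  unfolding fixf_def by clarsimp (metis B_inv_apply(2))

lemma card_fixf_sum:
  "card (fixf n u) * card (fixf n v)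
    = card ((\<lambda>(a, b). a + b) ` (fixf n u \<times> fixf n v)) * card (fixf n u \<inter> fixf n v)"
  by (intro card_subgroup_sum) (auto intro: fixf_diff)

lemma fixf_sum_sub: "(\<lambda>(a, b). a + b) ` (fixf n u \<times> fixf n v) \<subseteq> oddf n"
  using fixf_sub[of n] oddf_add by fast

text \<open>The cardinality form of the order equates two products whose factors are bounded
  separately: the sums lie in \<open>oddf n\<close>, the intersection lies in
  \<open>fixf n v\<close>. Positivity turns both inclusions into equalities.\<close>

lemma leT_decomp:
  assumes "u \<in> B n" "v \<in> B n" "leT n u v"
  shows "fixf n v \<subseteq> fixf n u"
    and "\<And>f. f \<in> oddf n \<Longrightarrow> \<exists>g\<in>fixf n u. \<exists>h\<in>fixf n (inv u \<circ> v). f = g + h"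
proof -
  let ?S = "(\<lambda>(a, b). a + b) ` (fixf n u \<times> fixf n (inv u \<circ> v))"
  let ?I = "fixf n u \<inter> fixf n (inv u \<circ> v)"
  have eq: "card ?S * card ?I = card (oddf n) * card (fixf n v)"
    using leT_card assms card_fixf_sum by metis
  have S: "card ?S \<le> card (oddf n)" by (intro card_mono finite_oddf fixf_sum_sub)
  have I: "card ?I \<le> card (fixf n v)" by (intro card_mono finite_fixf fixf_Int_sub assms)
  have pos: "card (oddf n) > 0" "card (fixf n v) > 0"
    using card_fixf_pos[of n v] card_fixf_pos[of n id] by (simp_all add: fixf_id)
  have "card ?I = card (fixf n v)"
  proof (rule ccontr)
    assume "card ?I \<noteq> card (fixf n v)"
    with I have "card ?I < card (fixf n v)" by simp
    then have "card (oddf n) * card ?I < card (oddf n) * card (fixf n v)" using pos by simp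
    moreover have "card ?S * card ?I \<le> card (oddf n) * card ?I" using S by (rule mult_le_mono1)
    ultimately show False using eq by linarith
  qed
  then have "?I = fixf n v" by (intro card_subset_eq finite_fixf fixf_Int_sub assms)
  then show "fixf n v \<subseteq> fixf n u" by blast
  have "card ?S * card (fixf n v) = card (oddf n) * card (fixf n v)"
    using eq unfolding \<open>card ?I = card (fixf n v)\<close> .
  then have "card ?S = card (oddf n)" using pos(2) by (metis mult_right_cancel less_not_refl)
  then have "?S = oddf n" by (intro card_subset_eq finite_oddf fixf_sum_sub)
  then show "\<exists>g\<in>fixf n u. \<exists>h\<in>fixf n (inv u \<circ> v). f = g + h" if "f \<in> oddf n" for f
  proof -
    from that \<open>?S = oddf n\<close> have "f \<in> ?S" by blast
    then show ?thesis by (elim imageE) auto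
  qed
qed

lemma leT_I:
  assumes "u \<in> B n" "v \<in> B n" "fixf n v \<subseteq> fixf n u"
    and dec: "\<And>f. f \<in> oddf n \<Longrightarrow> \<exists>g\<in>fixf n u. \<exists>h\<in>fixf n (inv u \<circ> v). f = g + h"
  shows "leT n u v"
proof -
  let ?S = "(\<lambda>(a, b). a + b) ` (fixf n u \<times> fixf n (inv u \<circ> v))"
  have "oddf n \<subseteq> ?S"
  proof
    fix f assume "f \<in> oddf n"
    then obtain g h where "g \<in> fixf n u" "h \<in> fixf n (inv u \<circ> v)" "f = g + h" using dec by blast
    then show "f \<in> ?S" by (intro image_eqI[of _ _ "(g, h)"]) auto
  qed
  with fixf_sum_sub have "?S = oddf n" by blast
  moreover have "fixf n v \<subseteq> fixf n (inv u \<circ> v)"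
  proof
    fix f assume f: "f \<in> fixf n v"
    then have "f \<in> fixf n (inv u)" using assms(3) fixf_inv[OF assms(1)] by blast
    with f show "f \<in> fixf n (inv u \<circ> v)" by (simp add: fixf_def)
  qed
  then have "fixf n u \<inter> fixf n (inv u \<circ> v) = fixf n v" using fixf_Int_sub assms by blast
  ultimately show ?thesis using leT_card[OF assms(1,2)] card_fixf_sum by metis
qed

lemma leT_antisym: "u \<in> B n \<Longrightarrow> v \<in> B n \<Longrightarrow> leT n u v \<Longrightarrow> leT n v u \<Longrightarrow> u = v"
proof -
  assume *: "u \<in> B n" "v \<in> B n" "leT n u v" "leT n v u"
  then have "lenT n (inv u \<circ> v) = 0" by (simp add: leT_def)
  then have "inv u \<circ> v = id" using lenT_eq_0 B_comp B_inv * by blast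
  then show "u = v" using * by (metis B_inv_o(2) comp_assoc comp_id id_comp)
qed

lemma leT_id: "u \<in> B n \<Longrightarrow> leT n id u"
  using lenT_eq_0[OF B_id, of n] by (simp add: leT_def)

text \<open>Fixing a reflection costs a factor of at most 3, and removing it from \<open>w\<close>
  gains at least 3, so the product of the two counts is at least the value in
  \<open>leT_card\<close>; the sum formula bounds it from above. An upper bound of all these
  reflections in \<open>NC n\<close> will have to relate \<open>x\<close> to
  \<open>w x\<close>.\<close>

lemma leT_step:
  assumes w: "w \<in> B n" and x: "x \<in> pm n" "w x \<noteq> x"
  shows "leT n (refl2 x (w x)) w"
proof -
  let ?t = "refl2 x (w x)"
  have wx: "w x \<in> pm n" using B_pm_iff w x by blast
  have t: "?t \<in> B n" using refl2_B x wx by blast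
  have 1: "card (oddf n) \<le> 3 * card (fixf n ?t)"
    using card_fixf_le[OF x(1) wx, of id] fixf_sub[of n ?t] by (simp add: fixf_id Int_absorb1)
  have 2: "3 * card (fixf n w) \<le> card (fixf n (inv ?t \<circ> w))"
    using card_fixf_step_ge[OF w x] inv_refl2[OF x(1) wx] by simp
  let ?S = "(\<lambda>(a, b). a + b) ` (fixf n ?t \<times> fixf n (inv ?t \<circ> w))"
  let ?I = "fixf n ?t \<inter> fixf n (inv ?t \<circ> w)"
  have S: "card ?S * card ?I \<le> card (oddf n) * card (fixf n w)"
    by (intro mult_le_mono card_mono finite_oddf finite_fixf fixf_sum_sub fixf_Int_sub t)
  have "3 * (card (oddf n) * card (fixf n w)) \<le> (3 * card (fixf n ?t)) * card (fixf n (inv ?t \<circ> w))"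
    using mult_le_mono[OF 1 2] by simp
  then have "card (oddf n) * card (fixf n w) \<le> card (fixf n ?t) * card (fixf n (inv ?t \<circ> w))" by simp
  with S have "card (fixf n ?t) * card (fixf n (inv ?t \<circ> w)) = card (oddf n) * card (fixf n w)"
    using card_fixf_sum[of n ?t "inv ?t \<circ> w"] by linarith
  then show ?thesis using leT_card[OF t w] by simp
qed

section \<open>The circle\<close>

text \<open>On \<open>pm n\<close>, the number of applications of \<open>cox n\<close> leading from
  \<open>a\<close> to \<open>b\<close>, between 0 and 2n - 1.\<close>

definition cdist :: "nat \<Rightarrow> int \<Rightarrow> int \<Rightarrow> int" where
  "cdist n a b = (if rk n a \<le> rk n b then rk n b - rk n a else rk n b - rk n a + 2 * int n)"

lemma rk_bounds: "x \<in> pm n \<Longrightarrow> 1 \<le> rk n x \<and> rk n x \<le> 2 * int n"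
  by (auto simp: rk_def pm_def)

lemma rk_inj: "x \<in> pm n \<Longrightarrow> y \<in> pm n \<Longrightarrow> rk n x = rk n y \<longleftrightarrow> x = y"
  by (auto simp: rk_def pm_def)

lemma cdist_nonneg: "a \<in> pm n \<Longrightarrow> b \<in> pm n \<Longrightarrow> 0 \<le> cdist n a b"
  using rk_bounds[of a n] rk_bounds[of b n] by (auto simp: cdist_def)

lemma cdist_less: "a \<in> pm n \<Longrightarrow> b \<in> pm n \<Longrightarrow> cdist n a b < 2 * int n"
  using rk_bounds[of a n] rk_bounds[of b n] by (auto simp: cdist_def)

lemma cdist_self [simp]: "cdist n a a = 0"
  by (simp add: cdist_def)

lemma cdist_eq_0: "a \<in> pm n \<Longrightarrow> b \<in> pm n \<Longrightarrow> cdist n a b = 0 \<longleftrightarrow> a = b"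
  using rk_bounds[of a n] rk_bounds[of b n] rk_inj[of a n b] by (auto simp: cdist_def)

lemma cdist_pos: "a \<in> pm n \<Longrightarrow> b \<in> pm n \<Longrightarrow> a \<noteq> b \<Longrightarrow> 0 < cdist n a b"
  using cdist_eq_0[of a n b] cdist_nonneg[of a n b] by auto

text \<open>Change of base point: once all distances are measured from one point \<open>a\<close>,
  circular order becomes a case distinction in linear arithmetic.\<close>

lemma cdist_base:
  "a \<in> pm n \<Longrightarrow> x \<in> pm n \<Longrightarrow> y \<in> pm n \<Longrightarrow> cdist n x y =
    (if cdist n a x \<le> cdist n a y then cdist n a y - cdist n a x
     else cdist n a y - cdist n a x + 2 * int n)"
  using rk_bounds[of a n] rk_bounds[of x n] rk_bounds[of y n] by (auto simp: cdist_def)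

lemma cdist_inj: "a \<in> pm n \<Longrightarrow> x \<in> pm n \<Longrightarrow> y \<in> pm n \<Longrightarrow> cdist n a x = cdist n a y \<longleftrightarrow> x = y"
  using cdist_base[of a n x y] cdist_eq_0[of x n y] by auto

lemma cdist_minus: "x \<in> pm n \<Longrightarrow> y \<in> pm n \<Longrightarrow> cdist n (- x) (- y) = cdist n x y"
  by (auto simp: cdist_def rk_def pm_def)

text \<open>Negation is the half turn, as the ranks of \<open>y\<close> and \<open>- y\<close>
  differ by n.\<close>

lemma cdist_minus_right:
  "x \<in> pm n \<Longrightarrow> y \<in> pm n \<Longrightarrow> cdist n x (- y) =
    (if cdist n x y < int n then cdist n x y + int n else cdist n x y - int n)"
  by (auto simp: cdist_def rk_def pm_def)

lemma rk_cox: "y \<in> pm n \<Longrightarrow> rk n (cox n y) = (if rk n y = 2 * int n then 1 else rk n y + 1)"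
  by (auto simp: rk_def pm_def cox_def)

lemma cdist_cox:
  "x \<in> pm n \<Longrightarrow> y \<in> pm n \<Longrightarrow> cdist n x (cox n y) =
    (if cdist n x y = 2 * int n - 1 then 0 else cdist n x y + 1)"
  using rk_bounds[of x n] rk_bounds[of y n] rk_cox[of y n] by (auto simp: cdist_def)

lemma cox_pm: "x \<in> pm n \<Longrightarrow> cox n x \<in> pm n"
  by (auto simp: pm_def cox_def)

lemma cox_minus: "cox n (- x) = - cox n x"
  by (auto simp: pm_def cox_def)

lemma cox_B: "cox n \<in> B n"
proof -
  have inj: "inj_on (cox n) (pm n)" by (rule inj_onI) (auto simp: cox_def pm_def split: if_splits)
  moreover have "cox n ` pm n \<subseteq> pm n" using cox_pm by blast
  ultimately have "cox n ` pm n = pm n" by (intro endo_inj_surj finite_pm)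
  then show ?thesis using inj cox_minus by (auto simp: B_def bij_betw_def cox_def)
qed

lemma cox_induct:
  assumes "x \<in> pm n" "y \<in> pm n" "P x" "\<And>z. z \<in> pm n \<Longrightarrow> P z \<Longrightarrow> P (cox n z)"
  shows "P y"
  using assms
proof (induction "nat (cdist n x y)" arbitrary: x)
  case 0
  then show ?case using cdist_eq_0[of x n y] cdist_nonneg[of x n y] by auto
next
  case (Suc k)
  have "cdist n x (cox n x) = 1" using cdist_cox[of x n x] Suc.prems(1) by (auto simp: pm_def)
  then have "cdist n (cox n x) y = cdist n x y - 1"
    using cdist_base[of x n "cox n x" y] Suc.prems cox_pm Suc.hyps(2) by auto
  with Suc.hyps(2) have "k = nat (cdist n (cox n x) y)" by auto
  then show ?case using Suc.hyps(1)[of "cox n x"] Suc.prems cox_pm by blast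
qed

section \<open>Arcs that a permutation maps into themselves\<close>

definition arc :: "nat \<Rightarrow> int \<Rightarrow> int \<Rightarrow> int set" where
  "arc n a b = {z \<in> pm n. 0 < cdist n a z \<and> cdist n a z < cdist n a b}"

text \<open>Inclusion amounts to equality, since arcs are finite and the maps injective. The arc of
  a fixed point is empty rather than the rest of the circle, so fixed points impose no
  condition.\<close>

definition arcinv :: "nat \<Rightarrow> (int \<Rightarrow> int) \<Rightarrow> bool" where
  "arcinv n y \<longleftrightarrow> (\<forall>a\<in>pm n. \<forall>z\<in>arc n a (y a). y z \<in> arc n a (y a))"

lemma arc_pm: "z \<in> arc n a b \<Longrightarrow> z \<in> pm n"
  by (simp add: arc_def)

lemma finite_arc [simp]: "finite (arc n a b)"
  using finite_pm by (simp add: arc_def)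

text \<open>Decompose \<open>delta a = g + h\<close> with \<open>g\<close> invariant under \<open>y\<close>. The differences of \<open>g\<close> along the
  circle are then known, and they force \<open>g\<close> to be the indicator of \<open>- arc n a (y a)\<close> minus that
  of \<open>arc n a (y a)\<close>.\<close>

lemma leT_cox_arcinv:
  assumes y: "y \<in> B n" and le: "leT n y (cox n)"
  shows "arcinv n y"
  unfolding arcinv_def
proof (intro ballI)
  fix a z assume a: "a \<in> pm n" and z: "z \<in> arc n a (y a)"
  have ya: "y a \<in> pm n" using B_pm_iff y a by blast
  have nfix: "y a \<noteq> a" using z by (auto simp: arc_def)
  define e where "e = cdist n a (y a)"
  have e: "0 < e" "e < 2 * int n" using cdist_pos[OF a ya] nfix cdist_less[OF a ya] by (auto simp: e_def)
  obtain g h where g: "g \<in> fixf n y" and h: "h \<in> fixf n (inv y \<circ> cox n)" and gh: "delta a = g + h"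
    using leT_decomp(2)[OF y cox_B le delta_oddf[OF a]] by blast
  define I :: "int \<Rightarrow> 3" where "I x = (if x \<in> arc n a (y a) then 1 else 0)" for x
  define G where "G x = I (- x) - I x" for x
  \<comment> \<open>Going round the circle, the indicator jumps up just after \<open>a\<close> and
    down on reaching \<open>y a\<close>; for \<open>e = 1\<close> the arc is empty and the two jumps
    cancel.\<close>
  have I_cox: "I (cox n x) - I x = (if x = a then 1 else 0) - (if cox n x = y a then 1 else 0)"
    if x: "x \<in> pm n" for x
  proof -
    have "x = a \<longleftrightarrow> cdist n a x = 0" using cdist_eq_0[OF a x] by auto
    moreover have "cox n x = y a \<longleftrightarrow> cdist n a (cox n x) = e"
      using cdist_inj[OF a cox_pm[OF x] ya] by (simp add: e_def)
    moreover have "x \<in> arc n a (y a) \<longleftrightarrow> 0 < cdist n a x \<and> cdist n a x < e"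
      "cox n x \<in> arc n a (y a) \<longleftrightarrow> 0 < cdist n a (cox n x) \<and> cdist n a (cox n x) < e"
      using x cox_pm by (auto simp: arc_def e_def)
    ultimately show ?thesis
      using cdist_cox[OF a x] e cdist_nonneg[OF a x] by (auto simp: I_def)
  qed
  have G_cox: "G (cox n x) - G x = delta a (inv y (cox n x)) - delta a x" if x: "x \<in> pm n" for x
  proof -
    have 1: "inv y (cox n x) = a \<longleftrightarrow> cox n x = y a"
      using B_inv_apply[OF y] by metis
    have 2: "inv y (cox n x) = - a \<longleftrightarrow> - cox n x = y a"
      using B_inv_apply[OF y] B_minus[OF y] by (metis minus_minus)
    have 3: "x = - a \<longleftrightarrow> - x = a" by auto
    have "G (cox n x) - G x = (I (cox n (- x)) - I (- x)) - (I (cox n x) - I x)"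
      by (simp add: G_def cox_minus)
    also have "\<dots> = delta a (inv y (cox n x)) - delta a x"
      unfolding I_cox[OF x] I_cox[OF iffD2[OF pm_minus x]] unfolding delta_def 1 2 3 cox_minus by simp
    finally show ?thesis .
  qed
  \<comment> \<open>Invariance gives \<open>g (inv y (cox n x)) = g (cox n x)\<close> and
    \<open>h (inv y (cox n x)) = h x\<close>; substituting \<open>h = delta a - g\<close> leaves the
    increments of \<open>g\<close>.\<close>
  have g_cox: "g (cox n x) - g x = delta a (inv y (cox n x)) - delta a x" for x
  proof -
    have "g (inv y (cox n x)) = g (cox n x)" using g fixf_inv[OF y] by (auto simp: fixf_def)
    moreover have "h (inv y (cox n x)) = h x" using h by (auto simp: fixf_def)
    ultimately show ?thesis by (simp add: gh)
  qed
  \<comment> \<open>\<open>g - G\<close> has zero increments, so it is constant on the circle; being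
    odd, the constant is its own negative.\<close>
  have gG: "g x = G x" if x: "x \<in> pm n" for x
  proof -
    have "g (- x) - G (- x) = g x - G x"
    proof (rule cox_induct[of x n "- x" "\<lambda>u. g u - G u = g x - G x"])
      fix u assume u: "u \<in> pm n" "g u - G u = g x - G x"
      have "g (cox n u) - g u = G (cox n u) - G u" using g_cox G_cox[OF u(1)] by simp
      with u(2) show "g (cox n u) - G (cox n u) = g x - G x"
        by (metis (no_types, lifting) add_diff_cancel_left' add_diff_eq diff_add_cancel diff_diff_eq2)
    qed (use x in auto)
    moreover have "g (- x) = - g x" using g by (auto simp: fixf_def oddf_def)
    moreover have "G (- x) = - G x" by (simp add: G_def)
    ultimately have "g x - G x = - (g x - G x)" by simp
    then show ?thesis using three_half[of "g x - G x"] by simp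
  qed
  have Gy: "G (y z) = G z"
  proof -
    have "g (y z) = g z" using g by (simp add: fixf_def)
    then show ?thesis using gG[OF arc_pm[OF z]] gG[of "y z"] arc_pm[OF z] B_pm_iff[OF y, of z] by simp
  qed
  have zp: "z \<in> pm n" "y z \<in> pm n" using arc_pm[OF z] B_pm_iff[OF y] by auto
  have mem: "x \<in> arc n a (y a) \<longleftrightarrow> 0 < cdist n a x \<and> cdist n a x < e" if "x \<in> pm n" for x
    using that by (simp add: arc_def e_def)
  show "y z \<in> arc n a (y a)"
  proof (rule ccontr)
    assume nz: "y z \<notin> arc n a (y a)"
    then have Gyz: "G (y z) = (if - y z \<in> arc n a (y a) then 1 else 0)" by (simp add: G_def I_def)
    have Gz: "G z = (if - z \<in> arc n a (y a) then 1 else 0) - 1" using z by (simp add: G_def I_def)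
    show False
    \<comment> \<open>An arc of at most half the circle is disjoint from its negative, so
      \<open>G z = - 1\<close>. For a longer arc the negative of every outside point is inside, so
      \<open>G (y z) = 1\<close>. Either way \<open>G z\<close> and \<open>G (y z)\<close>
      differ.\<close>
    proof (cases "e \<le> int n")
      case True
      then have "- z \<notin> arc n a (y a)"
        using z zp mem[of "- z"] mem[of z] cdist_minus_right[OF a zp(1)] by auto
      then show False using Gyz Gz Gy by (auto split: if_splits)
    next
      case False
      then have "- y z \<in> arc n a (y a)"
        using nz zp mem[of "- y z"] mem[of "y z"] cdist_minus_right[OF a zp(2)] e cdist_less[OF a zp(2)]
          cdist_nonneg[OF a zp(2)] by auto
      then show False using Gyz Gz Gy by (auto split: if_splits)
    qed
  qed
qed

lemma arcinv_iff:
  assumes y: "y \<in> B n" "arcinv n y" and a: "a \<in> pm n"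
  shows "y z \<in> arc n a (y a) \<longleftrightarrow> z \<in> arc n a (y a)"
proof
  let ?A = "arc n a (y a)"
  have "y ` ?A \<subseteq> ?A" using y(2) a by (auto simp: arcinv_def)
  moreover have "inj_on y ?A" using B_eq_iff[OF y(1)] by (simp add: inj_on_def)
  ultimately have "y ` ?A = ?A" by (intro endo_inj_surj) auto
  then show "z \<in> ?A" if "y z \<in> ?A" using that B_eq_iff[OF y(1)] by (metis imageE)
  show "y z \<in> ?A" if "z \<in> ?A" using that y(2) a by (auto simp: arcinv_def)
qed

section \<open>Orbits and their order on the circle\<close>

definition orb :: "(int \<Rightarrow> int) \<Rightarrow> int \<Rightarrow> int \<Rightarrow> bool" where
  "orb y a b \<longleftrightarrow> (\<exists>k. (y ^^ k) a = b)"

lemma orb_refl [simp]: "orb y a a"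
  unfolding orb_def by (rule exI[of _ 0]) simp

lemma orb_step: "orb y a (y a)"
  unfolding orb_def by (rule exI[of _ 1]) simp

lemma orb_trans: "orb y a b \<Longrightarrow> orb y b c \<Longrightarrow> orb y a c"
  unfolding orb_def by (metis add.commute comp_apply funpow_add)

lemma orb_inv:
  assumes "orb y a b" "a \<in> S" "\<And>x. x \<in> S \<Longrightarrow> y x \<in> S"
  shows "b \<in> S"
proof -
  have "(y ^^ k) a \<in> S" for k by (induction k) (use assms in auto)
  then show ?thesis using assms(1) by (auto simp: orb_def)
qed

lemma orb_pm: "y \<in> B n \<Longrightarrow> orb y a b \<Longrightarrow> b \<in> pm n \<longleftrightarrow> a \<in> pm n"
  using orb_inv[of y a b "pm n"] orb_inv[of y a b "- pm n"] B_pm_iff by auto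

text \<open>The successors of \<open>b\<close> form a finite set that \<open>y\<close> maps
  injectively into itself, hence onto it; so the steps from \<open>a\<close> to \<open>b\<close> can
  be undone inside this set.\<close>

lemma orb_sym:
  assumes y: "y \<in> B n" and ab: "orb y a b"
  shows "orb y b a"
proof -
  let ?O = "{x. orb y a x}"
  have fin: "finite ?O"
  proof (cases "a \<in> pm n")
    case True
    then show ?thesis using orb_pm[OF y] by (intro finite_subset[OF _ finite_pm[of n]]) auto
  next
    case False
    then have "y a = a" using B_outside[OF y] by blast
    then have "?O \<subseteq> {a}" using orb_inv[of y a _ "{a}"] by blast
    then show ?thesis using finite_subset by blast
  qed
  let ?P = "{x. orb y b x}"
  have P: "?P \<subseteq> ?O" using ab orb_trans by blast
  then have finP: "finite ?P" using fin finite_subset by blast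
  have "y ` ?P = ?P"
    using orb_trans[OF _ orb_step] B_eq_iff[OF y] by (intro endo_inj_surj finP) (auto simp: inj_on_def)
  then have inv: "y x \<in> ?P \<longleftrightarrow> x \<in> ?P" for x using B_eq_iff[OF y] by (metis image_iff)
  obtain k where "(y ^^ k) a = b" using ab by (auto simp: orb_def)
  then have "(y ^^ k) a \<in> ?P" by simp
  moreover have "(y ^^ k) a \<in> ?P \<Longrightarrow> a \<in> ?P" for k by (induction k) (use inv in auto)
  ultimately show ?thesis by blast
qed

text \<open>An orbit that enters the invariant arc could never return to \<open>a\<close>. In a
  nontrivial orbit, \<open>y a\<close> is therefore the first orbit point met after
  \<open>a\<close>.\<close>

lemma arcinv_orb:
  assumes y: "y \<in> B n" "arcinv n y" and a: "a \<in> pm n" and ab: "orb y a b"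
  shows "b \<notin> arc n a (y a)"
proof
  assume "b \<in> arc n a (y a)"
  then have "a \<in> arc n a (y a)"
    using orb_inv[OF orb_sym[OF y(1) ab]] arcinv_iff[OF y a] by blast
  then show False by (simp add: arc_def)
qed

text \<open>Equal cardinality makes \<open>y\<close> a bijection from \<open>S'\<close> to
  \<open>S\<close>. It is meant for segments of an orbit, half-open at opposite ends, and for whole
  orbits.\<close>

lemma sum_inv_shift:
  fixes f :: "int \<Rightarrow> 3"
  assumes y: "y \<in> B n" and "finite S" "card S = card S'" "y ` S' \<subseteq> S"
  shows "(\<Sum>x\<in>S. f (inv y x)) = sum f S'"
proof -
  have "inj_on y S'" using B_eq_iff[OF y] by (simp add: inj_on_def)
  moreover from this have "y ` S' = S" using assms card_image[of y S'] by (intro card_subset_eq) auto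
  ultimately have "(\<Sum>x\<in>S. f (inv y x)) = (\<Sum>x\<in>S'. f (inv y (y x)))"
    by (metis (no_types, lifting) sum.reindex_cong)
  then show ?thesis using y by simp
qed

text \<open>In \<open>f = g + h\<close> the invariance of \<open>g\<close> and \<open>h\<close> prescribes the differences of \<open>g\<close> between
  neighbours in a cycle of \<open>y\<close>; partial sums give \<open>g\<close>, and invariance of arcs makes the sum
  from \<open>q\<close> to \<open>p q\<close> vanish.\<close>

lemma arcinv_leT:
  assumes p: "p \<in> B n" "arcinv n p" and y: "y \<in> B n" "arcinv n y"
    and py: "\<And>x. orb y x (p x)"
  shows "leT n p y"
proof (rule leT_I[OF p(1) y(1)])
  show "fixf n y \<subseteq> fixf n p"
  proof
    fix f assume f: "f \<in> fixf n y"
    then have "f (p x) = f x" for x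
      using orb_inv[OF py, of x "{u. f u = f x}"] by (auto simp: fixf_def)
    with f show "f \<in> fixf n p" by (simp add: fixf_def)
  qed
next
  fix f assume f: "f \<in> oddf n"
  have f_minus: "f (- x) = - f x" for x
    using f by (auto simp: oddf_def)
  define Q where "Q z = {x. orb y z x}" for z
  \<comment> \<open>With \<open>h = f - g\<close>, the condition
    \<open>h (inv p (y x)) = h x\<close> becomes \<open>g (y x) - g x = F (y x)\<close>.\<close>
  define F where "F x = f (inv p x) - f (inv y x)" for x
  define g where "g z = sum F {x \<in> Q z. rk n x \<le> rk n z}" for z
  have Qpm: "Q z \<subseteq> pm n" if "z \<in> pm n" for z using that orb_pm[OF y(1)] by (auto simp: Q_def)
  have Qfin: "finite (Q z)" if "z \<in> pm n" for z using Qpm[OF that] finite_subset finite_pm by blast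
  have Qself: "z \<in> Q z" for z by (simp add: Q_def)
  have Qeq: "Q x = Q z" if "x \<in> Q z" for x z
  proof -
    have "orb y z x" "orb y x z" using that orb_sym[OF y(1)] by (auto simp: Q_def)
    then show ?thesis unfolding Q_def using orb_trans[of y] by blast
  qed
  have Qp: "p x \<in> Q z \<longleftrightarrow> x \<in> Q z" for x z
    using py[of x] orb_sym[OF y(1) py[of x]] orb_trans[of y] unfolding Q_def mem_Collect_eq by blast
  have Qy: "y x \<in> Q z \<longleftrightarrow> x \<in> Q z" for x z
    using orb_step[of y x] orb_sym[OF y(1) orb_step[of y x]] orb_trans[of y]
    unfolding Q_def mem_Collect_eq by blast
  have ysucc: "0 < cdist n x (y x) \<and> cdist n x (y x) \<le> cdist n x z"
    if "x \<in> pm n" "z \<in> Q x" "z \<noteq> x" for x z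
  proof -
    have yx: "y x \<in> pm n" using that B_pm_iff[OF y(1)] by blast
    have z: "z \<in> pm n" using Qpm that by blast
    have "y x \<noteq> x" using orb_inv[of y x z "{x}"] that by (auto simp: Q_def)
    then show ?thesis using arcinv_orb[OF y that(1), of z] that cdist_pos[OF that(1) yx]
      cdist_pos[OF that(1) z] z by (auto simp: Q_def arc_def)
  qed
  have F_minus: "F (- x) = - F x" for x
    using B_minus[OF B_inv[OF p(1)]] B_minus[OF B_inv[OF y(1)]] by (simp add: F_def f_minus)
  have p_out: "p x = x" if "y x = x" for x
    using orb_inv[OF py, of x "{x}"] that by auto
  have F_out: "F x = 0" if "y x = x" for x
    using B_inv_apply(1)[OF p(1), of x] B_inv_apply(1)[OF y(1), of x] that p_out[OF that]
    by (simp add: F_def)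
  have g_out: "g z = 0" if "z \<notin> pm n" for z
  proof -
    have yz: "y z = z" using B_outside[OF y(1) that] .
    have "Q z = {z}" using orb_inv[of y z _ "{z}"] yz by (auto simp: Q_def)
    then have "{x \<in> Q z. rk n x \<le> rk n z} = {z}" by auto
    then show ?thesis using F_out[OF yz] by (simp add: g_def)
  qed
  \<comment> \<open>Both \<open>p\<close> and \<open>y\<close> carry the orbit points from
    \<open>lo\<close> inclusive to \<open>hi\<close> exclusive onto those from \<open>lo\<close>
    exclusive to \<open>hi\<close> inclusive: \<open>y\<close> because it steps to the next orbit
    point, \<open>p\<close> because it preserves the arc between its two endpoints or the
    complementary one. Hence the two sums in \<open>F\<close> cancel.\<close>
  have seg: "sum F {x \<in> Q hi. rk n lo < rk n x \<and> rk n x \<le> rk n hi} = 0"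
    if hi: "hi \<in> pm n" and lo: "lo \<in> Q hi" and lh: "rk n lo < rk n hi"
      and pp: "hi = p lo \<or> lo = p hi" for lo hi
  proof -
    let ?S = "{x \<in> Q hi. rk n lo < rk n x \<and> rk n x \<le> rk n hi}"
    let ?S' = "{x \<in> Q hi. rk n lo \<le> rk n x \<and> rk n x < rk n hi}"
    let ?T = "{x \<in> Q hi. rk n lo < rk n x \<and> rk n x < rk n hi}"
    have lo_pm: "lo \<in> pm n" using lo Qpm hi by blast
    have eq_iff: "rk n x = rk n hi \<longleftrightarrow> x = hi" "rk n lo = rk n x \<longleftrightarrow> lo = x" if "x \<in> Q hi" for x
    proof -
      have "x \<in> pm n" using Qpm[OF hi] that by blast
      then show "rk n x = rk n hi \<longleftrightarrow> x = hi" "rk n lo = rk n x \<longleftrightarrow> lo = x"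
        using rk_inj hi lo_pm by simp_all
    qed
    have "x \<in> ?S \<longleftrightarrow> x \<in> insert hi ?T" for x
    proof (cases "x = hi")
      case False
      then show ?thesis using eq_iff(1)[of x] by (cases "x \<in> Q hi") (simp_all, linarith)
    qed (use lh Qself in simp)
    then have "?S = insert hi ?T" by (rule set_eqI)
    moreover have "x \<in> ?S' \<longleftrightarrow> x \<in> insert lo ?T" for x
    proof (cases "x = lo")
      case False
      then show ?thesis using eq_iff(2)[of x] by (cases "x \<in> Q hi") (simp_all, linarith)
    qed (use lh lo in simp)
    then have "?S' = insert lo ?T" by (rule set_eqI)
    ultimately have card: "card ?S = card ?S'" using Qfin[OF hi] by simp
    have yS: "y ` ?S' \<subseteq> ?S"
    proof clarify
      fix x assume x: "x \<in> Q hi" "rk n lo \<le> rk n x" "rk n x < rk n hi"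
      have x_pm: "x \<in> pm n" using x Qpm hi by blast
      have yx: "y x \<in> pm n" using x_pm B_pm_iff[OF y(1)] by blast
      have "hi \<in> Q x" "hi \<noteq> x" using Qeq[OF x(1)] Qself x by auto
      from ysucc[OF x_pm this] have "rk n x < rk n (y x) \<and> rk n (y x) \<le> rk n hi"
        using x(3) rk_bounds[OF x_pm] rk_bounds[OF yx] rk_bounds[OF hi]
        by (auto simp: cdist_def split: if_splits)
      then show "y x \<in> Q hi \<and> rk n lo < rk n (y x) \<and> rk n (y x) \<le> rk n hi"
        using x Qy by auto
    qed
    have pS: "p ` ?S' \<subseteq> ?S"
    proof clarify
      fix x assume x: "x \<in> Q hi" "rk n lo \<le> rk n x" "rk n x < rk n hi"
      have x_pm: "x \<in> pm n" using x Qpm hi by blast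
      have px: "p x \<in> pm n" using x_pm B_pm_iff[OF p(1)] by blast
      note bounds = rk_bounds[OF x_pm] rk_bounds[OF px] rk_bounds[OF hi] rk_bounds[OF lo_pm]
      have "rk n lo < rk n (p x) \<and> rk n (p x) \<le> rk n hi"
        using pp
      proof
        assume h: "hi = p lo"
        show ?thesis
        proof (cases "x = lo")
          case False
          then have "rk n lo < rk n x" using x rk_inj[OF lo_pm x_pm] by auto
          then have "x \<in> arc n lo (p lo)" using x x_pm h by (auto simp: arc_def cdist_def)
          then have "p x \<in> arc n lo (p lo)" using arcinv_iff[OF p lo_pm] by blast
          then show ?thesis using bounds lh h by (auto simp: arc_def cdist_def split: if_splits)
        qed (use h lh in auto)
      next
        assume h: "lo = p hi"
        have "x \<notin> arc n hi (p hi)" using x bounds lh h by (auto simp: arc_def cdist_def)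
        then have 1: "p x \<notin> arc n hi (p hi)" using arcinv_iff[OF p hi] by blast
        have "p x \<noteq> lo" using h x(3) B_eq_iff[OF p(1)] by auto
        then have "rk n (p x) \<noteq> rk n lo" using rk_inj[OF px lo_pm] by auto
        with 1 show ?thesis using px bounds lh h by (auto simp: arc_def cdist_def split: if_splits)
      qed
      then show "p x \<in> Q hi \<and> rk n lo < rk n (p x) \<and> rk n (p x) \<le> rk n hi"
        using x Qp by auto
    qed
    have fin: "finite ?S" using Qfin[OF hi] by simp
    show ?thesis unfolding F_def sum_subtractf
      using sum_inv_shift[OF p(1) fin card pS, of f] sum_inv_shift[OF y(1) fin card yS, of f] by simp
  qed
  have split: "g hi = g lo + sum F {x \<in> Q hi. rk n lo < rk n x \<and> rk n x \<le> rk n hi}"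
    if hi: "hi \<in> pm n" and lo: "lo \<in> Q hi" and lh: "rk n lo < rk n hi" for lo hi
  proof -
    have "{x \<in> Q hi. rk n x \<le> rk n hi} = {x \<in> Q lo. rk n x \<le> rk n lo}
        \<union> {x \<in> Q hi. rk n lo < rk n x \<and> rk n x \<le> rk n hi}"
      using Qeq[OF lo] lh by auto
    then show ?thesis unfolding g_def
      using Qfin[OF hi] Qeq[OF lo] by (simp only:) (intro sum.union_disjoint, auto)
  qed
  have g_p: "g (p q) = g q" for q
  proof (cases "q \<in> pm n")
    case True
    have pq: "p q \<in> pm n" using True B_pm_iff[OF p(1)] by blast
    have Q: "p q \<in> Q q" "q \<in> Q (p q)" using Qp[of q] Qself by auto
    consider "rk n q < rk n (p q)" | "rk n (p q) < rk n q" | "p q = q"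
      using rk_inj[OF pq True] by linarith
    then show ?thesis
    proof cases
      case 1
      then show ?thesis using split[OF pq Q(2) 1] seg[OF pq Q(2) 1] by simp
    next
      case 2
      then show ?thesis using split[OF True Q(1) 2] seg[OF True Q(1) 2] by simp
    qed simp
  qed (use B_outside[OF p(1)] in simp)
  have g_y: "g (y q) - g q = F (y q)" for q
  proof (cases "y q = q")
    case True
    then show ?thesis using F_out by simp
  next
    case False
    then have q: "q \<in> pm n" using B_outside[OF y(1)] by blast
    have yq: "y q \<in> pm n" using q B_pm_iff[OF y(1)] by blast
    have Q: "y q \<in> Q q" "q \<in> Q (y q)" using Qy[of q] Qself by auto
    have out: "\<not> (0 < cdist n q x \<and> cdist n q x < cdist n q (y q))" if "x \<in> Q q" for x
      using ysucc[OF q that] by (cases "x = q") auto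
    consider "rk n q < rk n (y q)" | "rk n (y q) < rk n q"
      using rk_inj[OF yq q] False by linarith
    then show ?thesis
    proof cases
      case 1
      have "{x \<in> Q (y q). rk n q < rk n x \<and> rk n x \<le> rk n (y q)} = {y q}"
      proof -
        have "x = y q" if x: "x \<in> Q q" "rk n q < rk n x" "rk n x \<le> rk n (y q)" for x
        proof -
          have "x \<in> pm n" using x Qpm q by blast
          moreover have "rk n x = rk n (y q)" using out[OF x(1)] x 1 by (auto simp: cdist_def)
          ultimately show ?thesis using rk_inj yq by blast
        qed
        then show ?thesis using Qeq[OF Q(1)] Q 1 by auto
      qed
      then show ?thesis using split[OF yq Q(2) 1] by simp
    next
      \<comment> \<open>This is the step from the largest orbit point back to the smallest. The
        partial sums close up because \<open>F\<close> has total 0 over the orbit.\<close>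
      case 2
      have b: "rk n (y q) \<le> rk n x \<and> rk n x \<le> rk n q" if x: "x \<in> Q q" for x
      proof -
        have "x \<in> pm n" using x Qpm q by blast
        then show ?thesis using out[OF x] 2 rk_bounds[of x n] rk_bounds[OF q] rk_bounds[OF yq]
          by (auto simp: cdist_def split: if_splits)
      qed
      have "{x \<in> Q (y q). rk n x \<le> rk n (y q)} = {y q}"
      proof -
        have "x = y q" if x: "x \<in> Q q" "rk n x \<le> rk n (y q)" for x
          using b[OF x(1)] x(2) rk_inj[OF _ yq, of x] Qpm[OF q] x(1) by auto
        then show ?thesis using Qeq[OF Q(1)] Q by auto
      qed
      then have 3: "g (y q) = F (y q)" by (simp add: g_def)
      have "{x \<in> Q q. rk n x \<le> rk n q} = Q q" using b by auto
      then have "g q = sum F (Q q)" by (simp add: g_def)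
      also have "\<dots> = 0" unfolding F_def sum_subtractf
        using sum_inv_shift[OF p(1) Qfin[OF q] refl, of f] sum_inv_shift[OF y(1) Qfin[OF q] refl, of f]
          Qp Qy by (simp add: image_subset_iff)
      finally show ?thesis using 3 by simp
    qed
  qed
  text \<open>In characteristic 3 the odd part \<open>(g z - g (- z)) / 2\<close> of \<open>g\<close> is \<open>g (- z) - g z\<close>.\<close>
  define g' where "g' z = g (- z) - g z" for z
  have 1: "g' \<in> fixf n p"
    using g_p B_minus[OF p(1)] g_out by (auto simp: fixf_def oddf_def g'_def) (metis g_p)
  have g'_y: "g' (y q) - g' q = F (y q)" for q
  proof -
    have "g' (y q) - g' q = (g (y (- q)) - g (- q)) - (g (y q) - g q)"
      unfolding g'_def B_minus[OF y(1)] by (simp add: algebra_simps)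
    also have "\<dots> = - F (y q) - F (y q)" unfolding g_y unfolding B_minus[OF y(1)] F_minus ..
    also have "\<dots> = F (y q)" using three_sum[of "F (y q)"] by (metis add_diff_cancel_right' diff_0 diff_diff_add minus_diff_commute)
    finally show ?thesis .
  qed
  have "f - g' \<in> fixf n (inv p \<circ> y)"
  proof -
    have "(f - g') (inv p (y x)) = (f - g') x" for x
    proof -
      have "g' (inv p (y x)) = g' (y x)" using 1 fixf_inv[OF p(1)] by (auto simp: fixf_def)
      then show ?thesis using g'_y[of x] y(1) unfolding F_def by (simp add: algebra_simps)
    qed
    moreover have "f - g' \<in> oddf n" using f 1 oddf_diff fixf_sub by blast
    ultimately show ?thesis by (simp add: fixf_def)
  qed
  moreover have "f = g' + (f - g')" by simp
  ultimately show "\<exists>g\<in>fixf n p. \<exists>h\<in>fixf n (inv p \<circ> y). f = g + h" using 1 by blast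
qed

section \<open>Noncrossing relations\<close>

text \<open>These are the noncrossing partitions of type B: partitions of 2n points on a circle,
  noncrossing and stable under the half turn.\<close>

definition ncrel :: "nat \<Rightarrow> (int \<Rightarrow> int \<Rightarrow> bool) \<Rightarrow> bool" where
  "ncrel n R \<longleftrightarrow> (\<forall>x\<in>pm n. R x x)
    \<and> (\<forall>x y. R x y \<longrightarrow> x \<in> pm n \<and> y \<in> pm n \<and> R y x \<and> R (- x) (- y))
    \<and> (\<forall>x y z. R x y \<longrightarrow> R y z \<longrightarrow> R x z)
    \<and> (\<forall>a b c d. R a c \<longrightarrow> R b d \<longrightarrow> 0 < cdist n a b \<longrightarrow> cdist n a b < cdist n a c \<longrightarrow>
        cdist n a c < cdist n a d \<longrightarrow> R a b)"

lemma
  assumes "ncrel n R"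
  shows ncrel_refl: "x \<in> pm n \<Longrightarrow> R x x"
    and ncrel_pm: "R x y \<Longrightarrow> x \<in> pm n" "R x y \<Longrightarrow> y \<in> pm n"
    and ncrel_sym: "R x y \<Longrightarrow> R y x"
    and ncrel_minus: "R x y \<Longrightarrow> R (- x) (- y)"
    and ncrel_trans: "R x y \<Longrightarrow> R y z \<Longrightarrow> R x z"
    and ncrel_cross: "R a c \<Longrightarrow> R b d \<Longrightarrow> 0 < cdist n a b \<Longrightarrow> cdist n a b < cdist n a c
      \<Longrightarrow> cdist n a c < cdist n a d \<Longrightarrow> R a b"
  using assms unfolding ncrel_def by blast+

text \<open>The usual passage from a noncrossing partition to a permutation: each block becomes a
  cycle in circular order.\<close>

definition next_in :: "nat \<Rightarrow> (int \<Rightarrow> int \<Rightarrow> bool) \<Rightarrow> int \<Rightarrow> int" where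
  "next_in n R x = (if \<exists>y. R x y \<and> y \<noteq> x
     then arg_min (\<lambda>y. nat (cdist n x y)) (\<lambda>y. R x y \<and> y \<noteq> x) else x)"

context
  fixes n R
  assumes R: "ncrel n R"
begin

lemma next_in_trivial: "(\<And>y. R x y \<Longrightarrow> y = x) \<Longrightarrow> next_in n R x = x"
  by (auto simp: next_in_def)

lemma next_in_props:
  assumes "R x y" "y \<noteq> x"
  shows "R x (next_in n R x)" "next_in n R x \<noteq> x"
    "cdist n x (next_in n R x) \<le> cdist n x y" "0 < cdist n x (next_in n R x)"
proof -
  let ?m = "arg_min (\<lambda>y. nat (cdist n x y)) (\<lambda>y. R x y \<and> y \<noteq> x)"
  have eq: "next_in n R x = ?m" using assms by (auto simp: next_in_def)
  have m: "R x ?m \<and> ?m \<noteq> x"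
    using arg_min_natI[of "\<lambda>y. R x y \<and> y \<noteq> x" y "\<lambda>y. nat (cdist n x y)"] assms by blast
  have le: "nat (cdist n x ?m) \<le> nat (cdist n x y)"
    using arg_min_nat_le[of "\<lambda>y. R x y \<and> y \<noteq> x" y "\<lambda>y. nat (cdist n x y)"] assms by blast
  have pm: "x \<in> pm n" "?m \<in> pm n" "y \<in> pm n" using m assms ncrel_pm[OF R] by blast+
  show "R x (next_in n R x)" "next_in n R x \<noteq> x" using m eq by auto
  show "0 < cdist n x (next_in n R x)" using cdist_pos[OF pm(1,2)] m eq by simp
  show "cdist n x (next_in n R x) \<le> cdist n x y"
    using le cdist_nonneg[OF pm(1,2)] cdist_nonneg[OF pm(1,3)] eq by simp
qed

lemma next_in_outside: "x \<notin> pm n \<Longrightarrow> next_in n R x = x"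
  using ncrel_pm(1)[OF R] by (intro next_in_trivial) blast

lemma next_in_rel: "x \<in> pm n \<Longrightarrow> R x (next_in n R x)"
  using next_in_props(1) next_in_trivial[of x] ncrel_refl[OF R, of x] by (cases "\<exists>y. R x y \<and> y \<noteq> x") auto

lemma next_in_unique:
  assumes "R x y" "y \<noteq> x" "\<And>z. R x z \<Longrightarrow> z \<noteq> x \<Longrightarrow> cdist n x y \<le> cdist n x z"
  shows "next_in n R x = y"
proof -
  note p = next_in_props[OF assms(1,2)]
  have "cdist n x (next_in n R x) = cdist n x y" using p(3) assms(3)[OF p(1,2)] by simp
  then show ?thesis using cdist_inj ncrel_pm[OF R p(1)] ncrel_pm[OF R assms(1)] by blast
qed

lemma next_in_minus: "next_in n R (- x) = - next_in n R x"
proof (cases "\<exists>y. R x y \<and> y \<noteq> x")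
  case True
  then obtain y where y: "R x y" "y \<noteq> x" by blast
  note p = next_in_props[OF y]
  show ?thesis
  proof (rule next_in_unique)
    show "R (- x) (- next_in n R x)" using ncrel_minus[OF R p(1)] .
    show "- next_in n R x \<noteq> - x" using p(2) by simp
    fix z assume z: "R (- x) z" "z \<noteq> - x"
    then have z': "R x (- z)" "- z \<noteq> x" using ncrel_minus[OF R z(1)] by auto
    have "cdist n x (next_in n R x) \<le> cdist n x (- z)" using next_in_props(3)[OF z'] .
    then show "cdist n (- x) (- next_in n R x) \<le> cdist n (- x) z"
      using cdist_minus[of x n "next_in n R x"] cdist_minus[of x n "- z"]
        ncrel_pm[OF R p(1)] ncrel_pm[OF R z'(1)] by simp
  qed
next
  case False
  have "R x (- y)" if "R (- x) y" for y using ncrel_minus[OF R that] by simp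
  then have "y = - x" if "R (- x) y" for y using False that by (metis minus_minus)
  then have "next_in n R (- x) = - x" by (rule next_in_trivial)
  moreover have "next_in n R x = x" using False by (intro next_in_trivial) blast
  ultimately show ?thesis by simp
qed

lemma next_in_inj: "x \<in> pm n \<Longrightarrow> y \<in> pm n \<Longrightarrow> next_in n R x = next_in n R y \<Longrightarrow> x = y"
proof (rule ccontr)
  assume xy: "x \<in> pm n" "y \<in> pm n" "next_in n R x = next_in n R y" and ne: "x \<noteq> y"
  let ?z = "next_in n R x"
  have "R x ?z" "R y ?z" using next_in_rel[OF xy(1)] next_in_rel[OF xy(2)] xy(3) by simp_all
  then have R': "R x y" "R y x" using ncrel_sym[OF R] ncrel_trans[OF R] by blast+
  note px = next_in_props[OF R'(1) not_sym[OF ne]] and py = next_in_props[OF R'(2) ne]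
  have z: "?z \<in> pm n" using ncrel_pm[OF R px(1)] by blast
  have "cdist n y ?z \<le> cdist n y x" "cdist n x ?z \<le> cdist n x y" "?z \<noteq> y" "0 < cdist n x ?z"
    using px py xy by auto
  moreover have "cdist n x ?z \<noteq> cdist n x y" using cdist_inj[OF xy(1) z xy(2)] \<open>?z \<noteq> y\<close> by blast
  ultimately show False
    using cdist_base[OF xy(1) xy(2) z] cdist_base[OF xy(1) xy(2) xy(1)] cdist_less[OF xy(1,2)]
    by (auto split: if_splits)
qed

lemma next_in_B: "next_in n R \<in> B n"
proof -
  have inj: "inj_on (next_in n R) (pm n)" using next_in_inj by (auto simp: inj_on_def)
  moreover have "next_in n R ` pm n \<subseteq> pm n" using next_in_rel ncrel_pm(2)[OF R] by blast
  ultimately have "next_in n R ` pm n = pm n" by (intro endo_inj_surj finite_pm)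
  then show ?thesis using inj next_in_minus next_in_outside by (auto simp: B_def bij_betw_def)
qed

text \<open>A point strictly between \<open>a\<close> and its successor is not related to
  \<open>a\<close>. If its own successor left the arc, either it would meet the class of
  \<open>a\<close> or the two classes would cross and hence coincide.\<close>

lemma next_in_arcinv: "arcinv n (next_in n R)"
  unfolding arcinv_def
proof (intro ballI)
  fix a z assume a: "a \<in> pm n" and z: "z \<in> arc n a (next_in n R a)"
  let ?p = "next_in n R"
  have zp: "z \<in> pm n" "?p z \<in> pm n" using z arc_pm next_in_rel ncrel_pm(2)[OF R] by blast+
  have nR: "\<not> R a z"
    using next_in_props(3)[of a z] z by (cases "z = a") (auto simp: arc_def)
  have Rz: "R z (?p z)" and Ra: "R a (?p a)" using next_in_rel zp a by auto
  have pa: "?p a \<in> pm n" using ncrel_pm(2)[OF R Ra] .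
  have 1: "?p z \<noteq> a" using nR Rz ncrel_sym[OF R] by blast
  have 2: "?p z \<noteq> ?p a"
  proof
    assume "?p z = ?p a"
    then have "R z (?p a)" using Rz by simp
    then show False using nR ncrel_trans[OF R Ra ncrel_sym[OF R]] by blast
  qed
  have 3: "\<not> cdist n a (?p a) < cdist n a (?p z)"
    using ncrel_cross[OF R Ra Rz] nR z by (auto simp: arc_def)
  show "?p z \<in> arc n a (?p a)"
  proof -
    have "0 < cdist n a (?p z)" using 1 cdist_pos[OF a zp(2)] by blast
    moreover have "cdist n a (?p z) \<noteq> cdist n a (?p a)" using 2 cdist_inj[OF a zp(2) pa] by blast
    ultimately show ?thesis using 3 zp(2) unfolding arc_def by simp
  qed
qed

lemma next_in_orb: "x \<in> pm n \<Longrightarrow> orb (next_in n R) x z \<longleftrightarrow> R x z"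
proof
  assume x: "x \<in> pm n"
  show "R x z" if "orb (next_in n R) x z"
  proof -
    have "z \<in> {z. R x z}"
    proof (rule orb_inv[OF that])
      fix y assume "y \<in> {z. R x z}"
      then have "R x y" by simp
      moreover from this have "R y (next_in n R y)" using next_in_rel ncrel_pm(2)[OF R] by blast
      ultimately show "next_in n R y \<in> {z. R x z}" using ncrel_trans[OF R] by blast
    qed (simp add: ncrel_refl[OF R x])
    then show ?thesis by simp
  qed
  assume "R x z"
  then show "orb (next_in n R) x z"
  proof (induction "nat (cdist n x z)" arbitrary: x rule: less_induct)
    case less
    show ?case
    proof (cases "z = x")
      case False
      let ?y = "next_in n R x"
      note p = next_in_props[OF less.prems False]
      have pm: "x \<in> pm n" "z \<in> pm n" "?y \<in> pm n" using ncrel_pm[OF R] less.prems p(1) by blast+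
      have "cdist n ?y z < cdist n x z"
        using cdist_base[OF pm(1,3,2)] p(3,4) by auto
      moreover have "R ?y z" using ncrel_trans[OF R ncrel_sym[OF R p(1)] less.prems] .
      ultimately have "orb (next_in n R) ?y z"
        using less.hyps[of ?y] cdist_pos[OF pm(1,2)] False by auto
      then show ?thesis using orb_trans[OF orb_step] by blast
    qed simp
  qed
qed

end

text \<open>For crossing orbits, walk from \<open>a\<close> along its orbit towards
  \<open>b\<close>. If \<open>b\<close> lies in the arc from \<open>a\<close> to \<open>y a\<close>,
  this arc traps the orbit of \<open>b\<close>, although \<open>d\<close> comes after
  \<open>c\<close> and \<open>c\<close> is outside the arc. Otherwise \<open>y a\<close> is
  \<open>b\<close> or replaces \<open>a\<close> at a smaller distance.\<close>

lemma orb_ncrel: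
  assumes y: "y \<in> B n" "arcinv n y"
  shows "ncrel n (\<lambda>a b. a \<in> pm n \<and> orb y a b)"
proof -
  have minus: "orb y (- a) (- b)" if "orb y a b" for a b
  proof -
    have "b \<in> {b. orb y (- a) (- b)}"
    proof (rule orb_inv[OF that])
      fix x assume "x \<in> {b. orb y (- a) (- b)}"
      then have "orb y (- a) (- x)" by simp
      moreover have "orb y (- x) (- y x)" using orb_step[of y "- x"] B_minus[OF y(1)] by simp
      ultimately have "orb y (- a) (- y x)" by (rule orb_trans)
      then show "y x \<in> {b. orb y (- a) (- b)}" by simp
    qed simp
    then show ?thesis by simp
  qed
  have cross: "orb y a b"
    if "a \<in> pm n" "b \<in> pm n" "orb y a c" "orb y b d" "0 < cdist n a b" "cdist n a b < cdist n a c"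
      "cdist n a c < cdist n a d" for a b c d
    using that
  proof (induction "nat (cdist n a b)" arbitrary: a rule: less_induct)
    case less
    note a = \<open>a \<in> pm n\<close> and b = \<open>b \<in> pm n\<close>
    have ya: "y a \<in> pm n" using B_pm_iff[OF y(1)] a by blast
    have c: "c \<in> pm n" and d: "d \<in> pm n" using orb_pm[OF y(1)] less.prems by blast+
    have "y a \<noteq> a"
      using orb_inv[OF less.prems(3), of "{a}"] less.prems(5,6) by auto
    then have pos: "0 < cdist n a (y a)" using cdist_pos[OF a ya] by simp
    have c_out: "c \<notin> arc n a (y a)" using arcinv_orb[OF y a less.prems(3)] .
    consider "b = y a" | "b \<in> arc n a (y a)" | "cdist n a (y a) < cdist n a b"
      using cdist_inj[OF a ya b] b less.prems(5) by (fastforce simp: arc_def)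
    then show ?case
    proof cases
      case 1
      then show ?thesis using orb_step by blast
    next
      case 2
      have "d \<in> arc n a (y a)"
        using orb_inv[OF less.prems(4) 2] arcinv_iff[OF y a] by blast
      then have False using c_out c less.prems(5-7) by (auto simp: arc_def)
      then show ?thesis ..
    next
      case 3
      have sh: "cdist n (y a) x = cdist n a x - cdist n a (y a)"
        if "x \<in> pm n" "cdist n a (y a) < cdist n a x" for x
        using cdist_base[OF a ya that(1)] that(2) by simp
      have "orb y (y a) c"
        using orb_trans[OF orb_sym[OF y(1) orb_step] less.prems(3)] .
      then have "orb y (y a) b"
        using less.hyps[of "y a"] ya b less.prems(4-7) 3 sh[OF b] sh[OF c] sh[OF d] pos by simp
      then show ?thesis using orb_trans[OF orb_step] by blast
    qed
  qed
  show ?thesis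
    unfolding ncrel_def
  proof (intro conjI allI ballI impI)
    fix a b c d
    assume "a \<in> pm n \<and> orb y a c" "b \<in> pm n \<and> orb y b d" "0 < cdist n a b"
      "cdist n a b < cdist n a c" "cdist n a c < cdist n a d"
    then show "orb y a b" using cross by blast
  qed (use minus orb_pm[OF y(1)] orb_sym[OF y(1)] in \<open>auto intro: orb_trans\<close>)
qed

text \<open>Any two distinct diameters cross, so there is at most one centrally symmetric
  class.\<close>

lemma ncrel_central:
  assumes R: "ncrel n R" and i: "R i (- i)" and j: "R j (- j)"
  shows "R i j"
proof (rule ccontr)
  assume nR: "\<not> R i j"
  have ij: "i \<in> pm n" "j \<in> pm n" using ncrel_pm[OF R] i j by blast+
  have ne: "i \<noteq> j" "j \<noteq> - i" using nR i ncrel_refl[OF R ij(1)] by auto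
  have d: "0 < cdist n i j" "cdist n i (- i) = int n" "cdist n i j \<noteq> int n"
    using cdist_pos[OF ij ne(1)] cdist_minus_right[OF ij(1,1)] ij(1)
      cdist_inj[OF ij(1) ij(2), of "- i"] ne ij by (auto simp: pm_def)
  have Rj': "R (- j) j" using ncrel_sym[OF R j] .
  show False
  proof (cases "cdist n i j < int n")
    case True
    then show False using ncrel_cross[OF R i j] nR d cdist_minus_right[OF ij] by simp
  next
    case False
    then have "R i (- j)" using ncrel_cross[OF R i Rj'] d cdist_minus_right[OF ij] cdist_less[OF ij] by simp
    then show False using nR ncrel_trans[OF R _ Rj'] by blast
  qed
qed

text \<open>The test function is the indicator of the class of \<open>a\<close> minus that of the
  negated class; \<open>w\<close> fixes it. If the class is not centrally symmetric, the value is 1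
  at \<open>a\<close> but 0 or - 1 at an unrelated point, so the reflection cannot fix it. Unrelated
  \<open>i\<close> and \<open>j\<close> would thus both lie in centrally symmetric classes, and
  these coincide.\<close>

lemma refl_leT_rel:
  assumes R: "ncrel n R" and w: "w \<in> B n" and Rw: "\<And>x. x \<in> pm n \<Longrightarrow> R x (w x)"
    and ij: "i \<in> pm n" "j \<in> pm n" and le: "leT n (refl2 i j) w"
  shows "R i j"
proof -
  have key: "R a (- a)" if nR: "\<not> R i j" and ab: "{a, b} = {i, j}" for a b
  proof -
    let ?f = "\<lambda>x. (if R a x then 1 else 0) - (if R a (- x) then 1 else 0) :: 3"
    have pm: "a \<in> pm n" "b \<in> pm n" using ab ij by (auto simp: doubleton_eq_iff)
    have Rw': "R a (w x) \<longleftrightarrow> R a x" for x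
    proof (cases "x \<in> pm n")
      case True
      then show ?thesis using Rw[OF True] ncrel_sym[OF R] ncrel_trans[OF R] by blast
    qed (use B_outside[OF w] in simp)
    have "?f \<in> oddf n" using ncrel_pm(2)[OF R] by (fastforce simp: oddf_def)
    moreover from this have "?f \<in> fixf n w" using Rw'[of "- _"] Rw' B_minus[OF w]
      by (simp add: fixf_def)
    then have "?f \<in> fixf n (refl2 i j)"
      using leT_decomp(1)[OF refl2_B[OF ij] w le] by blast
    ultimately have "?f i = ?f j" using oddf_refl2 ij by blast
    moreover have "a = i \<and> b = j \<or> a = j \<and> b = i" using ab by (auto simp: doubleton_eq_iff)
    ultimately have f: "?f a = ?f b" by metis
    have aa: "R a a" using ncrel_refl[OF R pm(1)] .
    have nab: "\<not> R a b" using nR ab ncrel_sym[OF R] by (auto simp: doubleton_eq_iff)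
    show ?thesis
    proof (rule ccontr)
      assume "\<not> R a (- a)"
      then show False using f aa nab by (cases "R a (- b)") simp_all
    qed
  qed
  show ?thesis
  proof (rule ccontr)
    assume nR: "\<not> R i j"
    then have Ri: "R i (- i)" and Rj: "R j (- j)" using key[of i j] key[of j i] by auto
    then show False using nR ncrel_central[OF R] by blast
  qed
qed

text \<open>The chord from \<open>a\<close> to \<open>b\<close> does not cross the chord from
  \<open>- a\<close> to \<open>- b\<close>: both of these negatives lie in the open arc from
  \<open>a\<close> to \<open>b\<close> if it exceeds a half circle, and neither does
  otherwise.\<close>

lemma refl2_arcinv:
  assumes ij: "i \<in> pm n" "j \<in> pm n" "i \<noteq> j"
  shows "arcinv n (refl2 i j)"
  unfolding arcinv_def
proof (intro ballI)
  fix a z assume a: "a \<in> pm n" and z: "z \<in> arc n a (refl2 i j a)"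
  have zp: "z \<in> pm n" using arc_pm z by blast
  have key: "refl2 a b z \<in> arc n a b" if b: "b \<in> pm n" and z: "z \<in> arc n a b" for b
  proof -
    have 0: "z \<noteq> a" "z \<noteq> b" using z by (auto simp: arc_def)
    have "- b \<in> arc n a b" if "z = - a"
    proof -
      have "int n < cdist n a b" using z that cdist_minus_right[OF a a] a by (auto simp: arc_def pm_def)
      then show ?thesis using cdist_minus_right[OF a b] b a by (auto simp: arc_def pm_def)
    qed
    moreover have "- a \<in> arc n a b" if "z = - b" "z \<noteq> - a"
    proof -
      have "b \<noteq> a" using that by auto
      then have "cdist n a b \<noteq> 0" using cdist_eq_0[OF a b] by simp
      then have "int n < cdist n a b" using z that cdist_minus_right[OF a b] a cdist_nonneg[OF a b]
         cdist_inj[OF a b, of "-a"] cdist_minus_right[OF a a] a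
        by (auto simp: arc_def pm_def split: if_splits)
      then show ?thesis using cdist_minus_right[OF a a] a by (auto simp: arc_def pm_def)
    qed
    ultimately show ?thesis using 0 z by (auto simp: refl2_def)
  qed
  have eq: "refl2 i j = refl2 j i" "refl2 i j = refl2 (- i) (- j)" "refl2 i j = refl2 (- j) (- i)"
    using ij by (auto simp: refl2_def fun_eq_iff pm_def)
  have "\<exists>b\<in>pm n. refl2 i j = refl2 a b" if "refl2 i j a \<noteq> a"
  proof -
    from that have "a = i \<or> a = j \<or> a = - i \<or> a = - j" by (auto simp: refl2_def split: if_splits)
    then show ?thesis using eq ij pm_minus by metis
  qed
  moreover have "refl2 i j a \<noteq> a" using z by (auto simp: arc_def)
  ultimately obtain b where b: "b \<in> pm n" "refl2 i j = refl2 a b" by blast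
  then have "refl2 i j a = b" by (simp add: refl2_def)
  then show "refl2 i j z \<in> arc n a (refl2 i j a)" using key b z by simp
qed

section \<open>The noncrossing closure of a permutation and the join\<close>

inductive ncl :: "nat \<Rightarrow> (int \<Rightarrow> int) \<Rightarrow> int \<Rightarrow> int \<Rightarrow> bool" for n w where
  ncl_refl: "x \<in> pm n \<Longrightarrow> ncl n w x x"
| ncl_step: "x \<in> pm n \<Longrightarrow> ncl n w x (w x)"
| ncl_sym: "ncl n w x y \<Longrightarrow> ncl n w y x"
| ncl_trans: "ncl n w x y \<Longrightarrow> ncl n w y z \<Longrightarrow> ncl n w x z"
| ncl_cross: "ncl n w a c \<Longrightarrow> ncl n w b d \<Longrightarrow> 0 < cdist n a b \<Longrightarrow> cdist n a b < cdist n a c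
    \<Longrightarrow> cdist n a c < cdist n a d \<Longrightarrow> ncl n w a b"

lemma ncl_pm: "w \<in> B n \<Longrightarrow> ncl n w x y \<Longrightarrow> x \<in> pm n \<and> y \<in> pm n"
  by (rotate_tac, induction rule: ncl.induct) (auto simp: B_pm_iff)

lemma ncl_ncrel:
  assumes w: "w \<in> B n"
  shows "ncrel n (ncl n w)"
proof -
  have "ncl n w (- x) (- y)" if "ncl n w x y" for x y
    using that
  proof (induction rule: ncl.induct)
    case (ncl_step x)
    then show ?case using ncl.ncl_step[of "- x" n w] B_minus[OF w, of x] by simp
  next
    case (ncl_cross a c b d)
    have "cdist n (- a) (- b) = cdist n a b" "cdist n (- a) (- c) = cdist n a c"
      "cdist n (- a) (- d) = cdist n a d"
      using ncl_pm[OF w] ncl_cross.hyps by (intro cdist_minus; blast)+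
    then show ?case using ncl.ncl_cross[OF ncl_cross.IH] ncl_cross.hyps by simp
  qed (auto intro: ncl.intros)
  then show ?thesis
    unfolding ncrel_def using ncl_pm[OF w] by (auto intro: ncl.ncl_refl ncl.ncl_sym)
       (blast intro: ncl.ncl_trans ncl.ncl_cross)+
qed

lemma ncl_least:
  assumes "ncl n w x y" "ncrel n R" "\<And>x. x \<in> pm n \<Longrightarrow> R x (w x)"
  shows "R x y"
  using assms(1)
proof (induction rule: ncl.induct)
  case (ncl_cross a c b d)
  then show ?case using ncrel_cross[OF assms(2)] by blast
qed (use assms(3) ncrel_refl[OF assms(2)] ncrel_sym[OF assms(2)] ncrel_trans[OF assms(2)] in blast)+

lemma cox_arcinv: "arcinv n (cox n)"
  using cdist_cox by (fastforce simp: arcinv_def arc_def)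

lemma cox_orb: "x \<in> pm n \<Longrightarrow> y \<in> pm n \<Longrightarrow> orb (cox n) x y"
  by (rule cox_induct[of x n y "orb (cox n) x"]) (auto intro: orb_trans[OF _ orb_step])

lemma arcinv_NC: "p \<in> B n \<Longrightarrow> arcinv n p \<Longrightarrow> p \<in> NC n"
proof -
  assume p: "p \<in> B n" "arcinv n p"
  have "orb (cox n) x (p x)" for x
    using cox_orb[of x n "p x"] B_pm_iff[OF p(1)] B_outside[OF p(1), of x] by (cases "x \<in> pm n") auto
  then have "leT n p (cox n)" using arcinv_leT[OF p cox_B cox_arcinv] by blast
  then show ?thesis using p leT_id by (simp add: NC_def)
qed

text \<open>The join is exhibited as a least upper bound. A reflection below \<open>w\<close>
  exchanges related points, hence lies below \<open>?p\<close>. Conversely, an element of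
  \<open>NC n\<close> above all of them is above each \<open>refl2 x (w x)\<close>, so its orbit
  relation, which is noncrossing, contains the closure.\<close>

lemma piT_eq:
  assumes w: "w \<in> B n"
  shows "piT n w = next_in n (ncl n w)"
proof -
  let ?R = "ncl n w" and ?p = "next_in n (ncl n w)"
  let ?T = "{t \<in> refls n. leT n t w}"
  note R = ncl_ncrel[OF w]
  have p: "?p \<in> B n" "arcinv n ?p" using next_in_B[OF R] next_in_arcinv[OF R] .
  have upper: "leT n t ?p" if t: "t \<in> ?T" for t
  proof -
    from t obtain i j where ij: "i \<in> pm n" "j \<in> pm n" "i \<noteq> j" "t = refl2 i j" "leT n t w"
      by (auto simp: refls_eq)
    have Rij: "?R i j"
      using refl_leT_rel[OF R w ncl_step ij(1,2)] ij by simp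
    have "?R x (t x)" if "x \<in> pm n" for x
      using Rij ncrel_sym[OF R] ncrel_minus[OF R] ncrel_refl[OF R that] ij(4) by (simp add: refl2_def)
    then have "orb ?p x (t x)" for x
      using next_in_orb[OF R] B_outside[OF refl2_B[OF ij(1,2)]] ij(4) by (cases "x \<in> pm n") auto
    then show ?thesis
      using arcinv_leT[OF refl2_B[OF ij(1,2)] refl2_arcinv[OF ij(1-3)] p] ij(4) by simp
  qed
  have least: "leT n ?p y" if y: "y \<in> NC n" "\<forall>t\<in>?T. leT n t y" for y
  proof -
    have yB: "y \<in> B n" and ya: "arcinv n y" using y(1) leT_cox_arcinv by (auto simp: NC_def)
    let ?O = "\<lambda>a b. a \<in> pm n \<and> orb y a b"
    note O = orb_ncrel[OF yB ya]
    have Ow: "?O x (w x)" if x: "x \<in> pm n" for x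
    proof (cases "w x = x")
      case False
      have wx: "w x \<in> pm n" using B_pm_iff[OF w] x by blast
      have "refl2 x (w x) \<in> ?T" using leT_step[OF w x False] x wx False by (force simp: refls_eq)
      then have "leT n (refl2 x (w x)) y" using y(2) by blast
      then show ?thesis using refl_leT_rel[OF O yB _ x wx] orb_step by blast
    qed (use x in simp)
    have "orb y x (?p x)" for x
    proof (cases "x \<in> pm n")
      case True
      then show ?thesis using ncl_least[OF next_in_rel[OF R True] O Ow] by blast
    qed (simp add: next_in_outside[OF R])
    then show ?thesis using arcinv_leT[OF p yB ya] by blast
  qed
  show ?thesis
    unfolding piT_def joinNC_def
  proof (rule the_equality)
    show "?p \<in> NC n \<and> (\<forall>t\<in>?T. leT n t ?p) \<and> (\<forall>y\<in>NC n. (\<forall>t\<in>?T. leT n t y) \<longrightarrow> leT n ?p y)"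
      using arcinv_NC[OF p] upper least by blast
    fix x assume x: "x \<in> NC n \<and> (\<forall>t\<in>?T. leT n t x) \<and> (\<forall>y\<in>NC n. (\<forall>t\<in>?T. leT n t y) \<longrightarrow> leT n x y)"
    then have "leT n x ?p" "leT n ?p x" using arcinv_NC[OF p] upper least by blast+
    then show "x = ?p" using leT_antisym x p(1) by (auto simp: NC_def)
  qed
qed

section \<open>Antiexceedances along a Pop orbit\<close>

lemma PopT_B: "w \<in> B n \<Longrightarrow> PopT n w \<in> B n"
  by (simp add: PopT_def piT_eq B_comp B_inv next_in_B ncl_ncrel)

lemma piT_B: "w \<in> B n \<Longrightarrow> piT n w \<in> B n"
  by (simp add: piT_eq next_in_B ncl_ncrel)

lemma PopT_piT: "w \<in> B n \<Longrightarrow> PopT n w (piT n w x) = w x"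
  using B_inv_apply(1)[OF piT_B] by (simp add: PopT_def)

text \<open>The partition into \<open>{q}\<close>, \<open>{- q}\<close> and the remaining points is
  noncrossing and every step of \<open>w\<close> stays inside a part, so the closure is at least as
  fine.\<close>

lemma ncl_fixpoint:
  assumes q: "w q = q" and w: "w \<in> B n" and "ncl n w q y"
  shows "y = q"
proof -
  let ?R = "\<lambda>x y. x \<in> pm n \<and> y \<in> pm n \<and> (x = q \<longleftrightarrow> y = q) \<and> (x = - q \<longleftrightarrow> y = - q)"
  have "ncrel n ?R"
    unfolding ncrel_def
  proof (intro conjI allI ballI impI; (elim conjE)?)
    fix a b c d
    assume "a = q \<longleftrightarrow> c = q" "a = - q \<longleftrightarrow> c = - q" "b = q \<longleftrightarrow> d = q" "b = - q \<longleftrightarrow> d = - q"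
      "0 < cdist n a b" "cdist n a b < cdist n a c" "cdist n a c < cdist n a d"
    then have "a \<noteq> q \<and> b \<noteq> q \<and> a \<noteq> - q \<and> b \<noteq> - q" by auto
    then show "a = q \<longleftrightarrow> b = q" "a = - q \<longleftrightarrow> b = - q" by auto
  qed auto
  moreover have "?R x (w x)" if "x \<in> pm n" for x
    using B_pm_iff[OF w, of x] B_eq_iff[OF w, of x q] B_eq_iff[OF w, of x "- q"] q
      B_minus[OF w, of q] that by auto
  ultimately have "?R q y" using ncl_least[OF assms(3)] by blast
  then show ?thesis by simp
qed

lemma piT_fixpoint_iff:
  assumes w: "w \<in> B n"
  shows "piT n w x = x \<longleftrightarrow> w x = x"
proof
  note R = ncl_ncrel[OF w]
  assume "w x = x"
  then show "piT n w x = x"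
    using ncl_fixpoint[OF _ w] next_in_trivial[OF R] piT_eq[OF w] by metis
next
  note R = ncl_ncrel[OF w]
  assume p: "piT n w x = x"
  show "w x = x"
  proof (cases "x \<in> pm n")
    case True
    then show ?thesis using next_in_props(2)[OF R ncl_step[OF True]] p piT_eq[OF w] by metis
  qed (use B_outside[OF w] in simp)
qed

text \<open>Antiexceedances indexed by their preimages: \<open>w\<close> maps
  \<open>desc n w\<close> bijectively onto \<open>antiexc n w\<close>.\<close>

definition desc :: "nat \<Rightarrow> (int \<Rightarrow> int) \<Rightarrow> int set" where
  "desc n w = {j \<in> pm n. rk n (w j) < rk n j}"

lemma finite_desc [simp]: "finite (desc n w)"
  by (simp add: desc_def)

lemma card_antiexc: "w \<in> B n \<Longrightarrow> card (antiexc n w) = card (desc n w)"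
proof -
  assume w: "w \<in> B n"
  have "w ` desc n w = antiexc n w"
  proof (intro equalityI subsetI)
    fix i assume i: "i \<in> antiexc n w"
    then have "inv w i \<in> desc n w" using w B_pm_iff[OF B_inv[OF w]] by (simp add: antiexc_def desc_def)
    then show "i \<in> w ` desc n w" using w by (intro image_eqI[of _ _ "inv w i"]) simp_all
  qed (use w B_pm_iff[OF w] in \<open>auto simp: antiexc_def desc_def\<close>)
  moreover have "inj_on w (desc n w)" using B_eq_iff[OF w] by (simp add: inj_on_def)
  ultimately show ?thesis by (metis card_image)
qed

text \<open>The circle is cut open before - 1. A point is then followed by the next larger element
  of its class, or it is the largest one and is sent to the smallest.\<close>

lemma next_in_linear:
  assumes R: "ncrel n R" and Rxy: "R x y" "y \<noteq> x"
  shows "rk n x < rk n (next_in n R x) \<Longrightarrow> rk n y < rk n x \<or> rk n (next_in n R x) \<le> rk n y"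
    and "rk n (next_in n R x) < rk n x \<Longrightarrow> rk n (next_in n R x) \<le> rk n y \<and> rk n y < rk n x"
proof -
  note p = next_in_props[OF R Rxy]
  have pm: "x \<in> pm n" "y \<in> pm n" "next_in n R x \<in> pm n"
    using ncrel_pm[OF R] Rxy p(1) by blast+
  note b = rk_bounds[OF pm(1)] rk_bounds[OF pm(2)] rk_bounds[OF pm(3)]
  have ne: "rk n x \<noteq> rk n y" using rk_inj[OF pm(1,2)] Rxy by auto
  show "rk n y < rk n x \<or> rk n (next_in n R x) \<le> rk n y" if "rk n x < rk n (next_in n R x)"
    using that p(3) b ne by (auto simp: cdist_def split: if_splits)
  show "rk n (next_in n R x) \<le> rk n y \<and> rk n y < rk n x" if "rk n (next_in n R x) < rk n x"
    using that p(3) b ne by (auto simp: cdist_def split: if_splits)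
qed

lemma next_in_class:
  assumes R: "ncrel n R" and x: "x \<in> pm n"
  shows "{(next_in n R ^^ k) x | k. True} = {z. R x z}"
proof -
  have "{(next_in n R ^^ k) x | k. True} = {z. orb (next_in n R) x z}" by (auto simp: orb_def)
  then show ?thesis by (simp add: next_in_orb[OF R x])
qed

text \<open>Every nontrivial class has exactly one descent of \<open>next_in n R\<close>, its largest element.\<close>

lemma card_desc_next_in:
  assumes R: "ncrel n R"
  shows "card (desc n (next_in n R)) = cyc n (next_in n R)"
proof -
  let ?p = "next_in n R" and ?cl = "\<lambda>x. {(next_in n R ^^ k) x | k. True}"
  note cl = next_in_class[OF R]
  have inj: "inj_on ?cl (desc n ?p)"
  proof (rule inj_onI, rule ccontr)
    fix x y assume x: "x \<in> desc n ?p" and y: "y \<in> desc n ?p" and eq: "?cl x = ?cl y" and ne: "x \<noteq> y"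
    have pm: "x \<in> pm n" "y \<in> pm n" using x y by (auto simp: desc_def)
    have "{z. R x z} = {z. R y z}" using eq unfolding cl[OF pm(1)] cl[OF pm(2)] .
    moreover have "y \<in> {z. R y z}" using ncrel_refl[OF R pm(2)] by simp
    ultimately have "y \<in> {z. R x z}" by simp
    then have "R x y" by simp
    then have "rk n y < rk n x" "rk n x < rk n y"
      using next_in_linear(2)[OF R] ncrel_sym[OF R] x y ne by (auto simp: desc_def)
    then show False by simp
  qed
  have "?cl ` desc n ?p = ?cl ` {x \<in> pm n. ?p x \<noteq> x}"
  proof (rule equalityI)
    show "?cl ` desc n ?p \<subseteq> ?cl ` {x \<in> pm n. ?p x \<noteq> x}" by (rule image_mono) (auto simp: desc_def)
    show "?cl ` {x \<in> pm n. ?p x \<noteq> x} \<subseteq> ?cl ` desc n ?p"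
    proof
      fix S assume "S \<in> ?cl ` {x \<in> pm n. ?p x \<noteq> x}"
      then obtain x where x: "x \<in> pm n" "?p x \<noteq> x" "S = ?cl x" by blast
      let ?C = "{z. R x z}"
      have Cpm: "?C \<subseteq> pm n" using ncrel_pm[OF R] by blast
      then have fin: "finite (rk n ` ?C)" using finite_subset finite_pm by blast
      have "Max (rk n ` ?C) \<in> rk n ` ?C" using fin ncrel_refl[OF R x(1)] by (intro Max_in) auto
      then obtain m where "m \<in> ?C" "Max (rk n ` ?C) = rk n m" by blast
      then have m: "m \<in> ?C" "\<forall>z\<in>?C. rk n z \<le> rk n m" using Max_ge[OF fin] by auto
      have m_pm: "m \<in> pm n" using m Cpm by blast
      have eqC: "{z. R m z} = ?C" using m(1) ncrel_sym[OF R] ncrel_trans[OF R] by blast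
      have "?p m \<noteq> m"
      proof -
        have "R x (?p x)" using next_in_rel[OF R x(1)] .
        then have "x \<in> {z. R m z}" "?p x \<in> {z. R m z}" using eqC ncrel_refl[OF R x(1)] by auto
        then show ?thesis using next_in_props(2)[OF R] x(2) by (metis mem_Collect_eq)
      qed
      moreover have "?p m \<in> ?C" using eqC next_in_rel[OF R m_pm] by blast
      moreover have "rk n (?p m) \<noteq> rk n m" using calculation rk_inj m_pm Cpm by blast
      ultimately have "m \<in> desc n ?p" using m m_pm by (force simp: desc_def)
      moreover have "S = ?cl m" using cl[OF x(1)] cl[OF m_pm] x(3) eqC by simp
      ultimately show "S \<in> ?cl ` desc n ?p" by blast
    qed
  qed
  then show ?thesis unfolding cyc_def using card_image[OF inj] by simp
qed

text \<open>Write \<open>p\<close> for \<open>piT n w\<close>. On a nontrivial class \<open>w\<close> has no fixed point and \<open>p\<close> steps to the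
  next larger element, so \<open>p q\<close> is a descent of \<open>PopT n w\<close> iff \<open>q\<close> is a descent of \<open>w\<close> other than the
  largest element of its class.\<close>

lemma card_desc_PopT:
  assumes w: "w \<in> B n"
  shows "card (desc n w) = card (desc n (PopT n w)) + cyc n (piT n w)"
proof -
  let ?R = "ncl n w" and ?p = "piT n w"
  note R = ncl_ncrel[OF w] and p = piT_B[OF w] and pe = piT_eq[OF w]
  define A where "A = {q \<in> pm n. rk n (w q) < rk n (?p q)}"
  have "desc n (PopT n w) = ?p ` A"
  proof (intro equalityI subsetI)
    fix j assume j: "j \<in> desc n (PopT n w)"
    have "inv ?p j \<in> A" using j PopT_piT[OF w, of "inv ?p j"] p B_pm_iff[OF B_inv[OF p]]
      by (simp add: A_def desc_def)
    then show "j \<in> ?p ` A" using p by (intro image_eqI[of _ _ "inv ?p j"]) simp_all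
  next
    fix j assume "j \<in> ?p ` A"
    then show "j \<in> desc n (PopT n w)" using PopT_piT[OF w] B_pm_iff[OF p] by (auto simp: A_def desc_def)
  qed
  moreover have "inj_on ?p A" using B_eq_iff[OF p] by (simp add: inj_on_def)
  ultimately have cA: "card (desc n (PopT n w)) = card A" by (simp add: card_image)
  have lin: "w q \<noteq> q \<and> (rk n q < rk n (?p q) \<and> (rk n (w q) < rk n q \<or> rk n (?p q) \<le> rk n (w q))
      \<or> rk n (?p q) < rk n q \<and> rk n (?p q) \<le> rk n (w q) \<and> rk n (w q) < rk n q)"
    if q: "q \<in> pm n" "w q \<noteq> q" for q
  proof -
    have "?p q \<noteq> q" using piT_fixpoint_iff[OF w] q by blast
    then have "rk n q < rk n (?p q) \<or> rk n (?p q) < rk n q"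
      using rk_inj[of "?p q" n q] q B_pm_iff[OF p] by auto
    then show ?thesis using next_in_linear[OF R ncl_step[OF q(1)] q(2)] q(2) pe by auto
  qed
  have triv: "w q = q \<Longrightarrow> ?p q = q" for q using piT_fixpoint_iff[OF w] by blast
  have "q \<in> desc n w \<longleftrightarrow> q \<in> A \<or> q \<in> desc n ?p" for q
    using lin[of q] triv[of q] by (cases "w q = q") (auto simp: desc_def A_def)
  then have "desc n w = A \<union> desc n ?p" by blast
  moreover have "A \<inter> desc n ?p = {}"
  proof -
    have "\<not> (q \<in> A \<and> q \<in> desc n ?p)" for q
      using lin[of q] triv[of q] by (cases "w q = q") (auto simp: desc_def A_def)
    then show ?thesis by blast
  qed
  ultimately have "card (desc n w) = card A + card (desc n ?p)"
    by (simp add: card_Un_disjoint A_def)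
  moreover have "card (desc n ?p) = cyc n ?p" unfolding pe by (rule card_desc_next_in[OF R])
  ultimately show ?thesis using cA by simp
qed

text \<open>A permutation preserves the sum of all ranks, so if no rank drops, none can
  rise.\<close>

lemma desc_empty:
  assumes w: "w \<in> B n" and e: "desc n w = {}"
  shows "w = id"
proof
  fix x
  have bij: "bij_betw w (pm n) (pm n)" using w by (simp add: B_def)
  have "(\<Sum>j\<in>pm n. rk n j) = (\<Sum>j\<in>pm n. rk n (w j))"
    using sum.reindex_bij_betw[OF bij, of "rk n"] by simp
  moreover have ge: "rk n j \<le> rk n (w j)" if "j \<in> pm n" for j using e that by (force simp: desc_def)
  ultimately have "rk n x = rk n (w x)" if "x \<in> pm n"
    using sum_mono_inv[of "rk n" "pm n" "\<lambda>j. rk n (w j)" x] that by simp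
  then show "w x = id x" using rk_inj[of x n "w x"] B_pm_iff[OF w, of x] B_outside[OF w, of x] by auto
qed

lemma cyc_pos:
  assumes w: "w \<in> B n" "w \<noteq> id"
  shows "cyc n (piT n w) > 0"
proof -
  obtain x where "w x \<noteq> x" using w(2) by (auto simp: fun_eq_iff)
  then have "piT n w x \<noteq> x" "x \<in> pm n" using piT_fixpoint_iff[OF w(1)] B_outside[OF w(1)] by blast+
  then show ?thesis unfolding cyc_def by (auto simp: card_gt_0_iff)
qed

lemma cyc_next_in_1:
  assumes R: "ncrel n R"
  shows "cyc n (next_in n R) = 1 \<longleftrightarrow> (\<exists>x\<in>pm n. next_in n R x \<noteq> x) \<and>
    (\<forall>x\<in>pm n. \<forall>y\<in>pm n. next_in n R x \<noteq> x \<longrightarrow> next_in n R y \<noteq> y \<longrightarrow> R x y)"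
proof -
  let ?cl = "\<lambda>x. {(next_in n R ^^ k) x | k. True}" and ?S = "{x \<in> pm n. next_in n R x \<noteq> x}"
  note cl = next_in_class[OF R]
  have img: "?cl ` ?S = (\<lambda>x. {z. R x z}) ` ?S" using cl by (intro image_cong) auto
  have eq: "{z. R x z} = {z. R y z} \<longleftrightarrow> R x y" if "x \<in> pm n" "y \<in> pm n" for x y
    using ncrel_sym[OF R] ncrel_trans[OF R] ncrel_refl[OF R] that by blast
  show ?thesis
  proof
    assume "cyc n (next_in n R) = 1"
    then obtain T where T: "(\<lambda>x. {z. R x z}) ` ?S = {T}" unfolding cyc_def img by (rule card_1_singletonE)
    have "?S \<noteq> {}" using T by auto
    moreover have "{z. R x z} = {z. R y z}" if "x \<in> ?S" "y \<in> ?S" for x y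
      using T imageI[OF that(1), of "\<lambda>x. {z. R x z}"] imageI[OF that(2), of "\<lambda>x. {z. R x z}"] by simp
    ultimately show "(\<exists>x\<in>pm n. next_in n R x \<noteq> x) \<and>
      (\<forall>x\<in>pm n. \<forall>y\<in>pm n. next_in n R x \<noteq> x \<longrightarrow> next_in n R y \<noteq> y \<longrightarrow> R x y)"
      using eq by blast
  next
    assume *: "(\<exists>x\<in>pm n. next_in n R x \<noteq> x) \<and>
      (\<forall>x\<in>pm n. \<forall>y\<in>pm n. next_in n R x \<noteq> x \<longrightarrow> next_in n R y \<noteq> y \<longrightarrow> R x y)"
    then obtain x where x: "x \<in> ?S" by blast
    have "{z. R y z} = {z. R x z}" if "y \<in> ?S" for y using * that x eq by blast
    then have "(\<lambda>x. {z. R x z}) ` ?S = {{z. R x z}}" using x by blast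
    then show "cyc n (next_in n R) = 1" unfolding cyc_def img by simp
  qed
qed

section \<open>Lengths of Pop orbits\<close>

lemma orbitPop_unfold: "orbitPop n w = insert w (orbitPop n (PopT n w))"
proof -
  have "(PopT n ^^ k) w \<in> insert w (orbitPop n (PopT n w))" for k
    unfolding orbitPop_def by (cases k) (auto simp: funpow_swap1 simp del: funpow.simps(2) simp: funpow_Suc_right)
  moreover have "w \<in> orbitPop n w" unfolding orbitPop_def by (auto intro: exI[of _ 0])
  moreover have "(PopT n ^^ k) (PopT n w) \<in> orbitPop n w" for k
    unfolding orbitPop_def using funpow_Suc_right[of k "PopT n"] by (auto intro!: exI[of _ "Suc k"] simp: funpow_swap1)
  ultimately show ?thesis unfolding orbitPop_def by blast
qed

lemma PopT_id: "PopT n id = id"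
proof -
  have "piT n id = id" using piT_fixpoint_iff[OF B_id] by auto
  then show ?thesis by (simp add: PopT_def)
qed

lemma orbitPop_id: "orbitPop n id = {id}"
proof -
  have "(PopT n ^^ k) id = id" for k using PopT_id[of n] by (induction k) (simp_all add: id_def)
  then show ?thesis by (simp add: orbitPop_def)
qed

lemma card_desc_PopT_le: "w \<in> B n \<Longrightarrow> card (desc n (PopT n w)) \<le> card (desc n w)"
  using card_desc_PopT by fastforce

lemma orbitPop_desc: "w \<in> B n \<Longrightarrow> v \<in> orbitPop n w \<Longrightarrow> card (desc n v) \<le> card (desc n w)"
proof -
  assume w: "w \<in> B n"
  have "(PopT n ^^ k) w \<in> B n \<and> card (desc n ((PopT n ^^ k) w)) \<le> card (desc n w)" for k
  proof (induction k)
    case (Suc k)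
    then show ?case using PopT_B[of "(PopT n ^^ k) w" n] card_desc_PopT_le[of "(PopT n ^^ k) w" n] by simp
  qed (use w in simp)
  then show "v \<in> orbitPop n w \<Longrightarrow> card (desc n v) \<le> card (desc n w)" by (auto simp: orbitPop_def)
qed

text \<open>The number of descents drops strictly at the first step and never rises again, so the
  orbit does not return to \<open>w\<close>.\<close>

lemma card_orbitPop_step:
  assumes w: "w \<in> B n" "w \<noteq> id" and fin: "finite (orbitPop n (PopT n w))"
  shows "card (orbitPop n w) = Suc (card (orbitPop n (PopT n w)))"
proof -
  have "w \<notin> orbitPop n (PopT n w)"
    using orbitPop_desc[OF PopT_B[OF w(1)], of w] card_desc_PopT[OF w(1)] cyc_pos[OF w] by linarith
  then show ?thesis using orbitPop_unfold[of n w] fin by simp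
qed

lemma card_orbitPop_le:
  "w \<in> B n \<Longrightarrow> finite (orbitPop n w) \<and> card (orbitPop n w) \<le> card (desc n w) + 1"
proof (induction "card (desc n w)" arbitrary: w rule: less_induct)
  case less
  show ?case
  proof (cases "w = id")
    case False
    have "card (desc n (PopT n w)) < card (desc n w)"
      using card_desc_PopT[OF less.prems] cyc_pos[OF less.prems False] by linarith
    with less.hyps[OF this PopT_B[OF less.prems]] show ?thesis
      using card_orbitPop_step[OF less.prems False] orbitPop_unfold[of n w] by auto
  qed (simp add: orbitPop_id)
qed

text \<open>The bound of \<open>card_orbitPop_le\<close> is attained: every step before the identity
  loses exactly one descent. Unlike a prescribed orbit size, this property is inherited by
  \<open>PopT n w\<close>, which makes it suitable for induction.\<close>

definition slow :: "nat \<Rightarrow> (int \<Rightarrow> int) \<Rightarrow> bool" where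
  "slow n w \<longleftrightarrow> card (orbitPop n w) = card (desc n w) + 1"

lemma slow_id: "slow n id"
  by (simp add: slow_def orbitPop_id desc_def)

lemma slow_step:
  assumes w: "w \<in> B n" "w \<noteq> id"
  shows "slow n w \<longleftrightarrow> cyc n (piT n w) = 1 \<and> slow n (PopT n w)"
  using card_orbitPop_step[OF w] card_orbitPop_le[OF PopT_B[OF w(1)]] card_desc_PopT[OF w(1)]
    cyc_pos[OF w] unfolding slow_def by linarith

section \<open>Centrally symmetric classes\<close>

text \<open>A class that is not centrally symmetric lies in a half circle starting at one of its elements:
  otherwise it would cross its negative.\<close>

lemma ncrel_first:
  assumes R: "ncrel n R" and x: "x \<in> pm n" and nx: "\<not> R x (- x)"
  obtains a where "R x a" "\<And>z. R x z \<Longrightarrow> cdist n a z < int n"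
proof -
  \<comment> \<open>The half circle considered starts at \<open>- x\<close> and ends at
    \<open>x\<close>; the point \<open>a\<close> will be the first one of the class in it.\<close>
  let ?P = "\<lambda>z. R x z \<and> cdist n (- x) z \<le> int n"
  have mx: "- x \<in> pm n" using x by simp
  have "?P x" using ncrel_refl[OF R x] cdist_minus_right[OF mx mx] x by (auto simp: pm_def)
  then obtain a where a: "?P a" "\<And>z. ?P z \<Longrightarrow> nat (cdist n (- x) a) \<le> nat (cdist n (- x) z)"
    using ex_has_least_nat[of ?P x "\<lambda>z. nat (cdist n (- x) z)"] by blast
  have apm: "a \<in> pm n" using ncrel_pm[OF R] a(1) by blast
  have apos: "0 < cdist n (- x) a" using cdist_pos[OF mx apm] a(1) nx by blast
  show ?thesis
  proof (rule that)
    show "R x a" using a(1) by blast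
    fix z assume z: "R x z"
    have zpm: "z \<in> pm n" using ncrel_pm[OF R z] by blast
    have b: "cdist n a z = (if cdist n (- x) a \<le> cdist n (- x) z then cdist n (- x) z - cdist n (- x) a
        else cdist n (- x) z - cdist n (- x) a + 2 * int n)"
      using cdist_base[OF mx apm zpm] .
    show "cdist n a z < int n"
    proof (cases "cdist n (- x) z \<le> int n")
      case True
      then have "cdist n (- x) a \<le> cdist n (- x) z"
        using a(2)[of z] z cdist_nonneg[OF mx apm] cdist_nonneg[OF mx zpm] by auto
      then show ?thesis using b True apos by simp
    next
      \<comment> \<open>Here \<open>z\<close> lies beyond \<open>x\<close>. If it also lay beyond
        \<open>- a\<close>, the chord from \<open>a\<close> to \<open>z\<close> would cross the
        chord from \<open>- x\<close> to \<open>- a\<close>.\<close>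
      case False
      have ma: "cdist n (- x) (- a) = cdist n (- x) a + int n"
        if "cdist n (- x) a < int n" using cdist_minus_right[OF mx apm] that by simp
      have Ra: "R a z" using ncrel_trans[OF R ncrel_sym[OF R] z] a(1) by blast
      have Rm: "R (- x) (- a)" using ncrel_minus[OF R] a(1) by blast
      have nRa: "\<not> R (- x) a" using nx a(1) ncrel_sym[OF R] ncrel_trans[OF R] by blast
      have "z \<noteq> - a" using z ncrel_trans[OF R z] ncrel_sym[OF R Rm] nx by blast
      then have "cdist n (- x) z \<noteq> cdist n (- x) (- a)"
        using cdist_inj[OF mx zpm] apm by simp
      moreover have "\<not> cdist n (- x) (- a) < cdist n (- x) z" if "cdist n (- x) a < int n"
        using ncrel_cross[OF R Rm Ra apos] ma[OF that] nRa that x by (auto simp: pm_def)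
      ultimately show ?thesis
        using b a(1) ma False cdist_less[OF mx zpm] by (cases "cdist n (- x) a < int n") auto
    qed
  qed
qed

text \<open>The map \<open>w\<close> moves every point at most a half turn forward, whereas the first element of a
  class that is not centrally symmetric is the image of a later element of the class.\<close>

lemma slow_half_turn:
  assumes "w \<in> B n" "\<And>x. x \<in> pm n \<Longrightarrow> cdist n x (w x) \<le> int n"
  shows "slow n w"
  using assms
proof (induction "card (desc n w)" arbitrary: w rule: less_induct)
  case less
  note w = less.prems(1) and half = less.prems(2)
  let ?R = "ncl n w" and ?p = "piT n w"
  note R = ncl_ncrel[OF w] and pe = piT_eq[OF w]
  show ?case
  proof (cases "w = id")
    case False
    have central: "?R x (- x)" if x: "x \<in> pm n" "?p x \<noteq> x" for x
    proof (rule ccontr)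
      assume "\<not> ?R x (- x)"
      then obtain a where a: "?R x a" "\<And>z. ?R x z \<Longrightarrow> cdist n a z < int n"
        using ncrel_first[OF R x(1)] by blast
      have apm: "a \<in> pm n" using ncrel_pm[OF R a(1)] by blast
      let ?b = "inv w a"
      have bpm: "?b \<in> pm n" using B_pm_iff[OF B_inv[OF w]] apm by blast
      have ba: "?R ?b a" using ncl_step[OF bpm, of w] w by simp
      have "w a \<noteq> a"
      proof
        assume "w a = a"
        then have "x = a" using ncl_fixpoint[OF _ w ncrel_sym[OF R a(1)]] by blast
        then show False using \<open>w a = a\<close> x(2) piT_fixpoint_iff[OF w] by blast
      qed
      then have ne: "?b \<noteq> a" using B_inv_apply(2)[OF w, of a] by metis
      \<comment> \<open>From \<open>a\<close> to its preimage is less than a half turn, and from the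
        preimage back to \<open>a\<close> is at most a half turn, yet together they make a full
        turn.\<close>
      have "cdist n a ?b < int n" using a(2) ncrel_trans[OF R a(1) ncrel_sym[OF R ba]] by blast
      moreover have "0 < cdist n a ?b" using cdist_pos[OF apm bpm] ne by simp
      moreover have "cdist n ?b a \<le> int n" using half[OF bpm] w by simp
      ultimately show False using cdist_base[OF apm bpm apm] by simp
    qed
    have "\<exists>x\<in>pm n. ?p x \<noteq> x"
      using False piT_fixpoint_iff[OF w] B_outside[OF w] by (metis eq_id_iff)
    then have "cyc n ?p = 1"
      using cyc_next_in_1[OF R] central ncrel_central[OF R] unfolding pe by blast
    moreover have "slow n (PopT n w)"
    proof (rule less.hyps)
      show "card (desc n (PopT n w)) < card (desc n w)"
        using card_desc_PopT[OF w] cyc_pos[OF w False] by linarith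
      show "PopT n w \<in> B n" using PopT_B[OF w] .
      \<comment> \<open>\<open>PopT n w\<close> sends \<open>?p ?x\<close> to \<open>w ?x\<close>,
        and \<open>?p ?x\<close> lies on the way from \<open>?x\<close> to \<open>w ?x\<close>; so
        the distance only shrinks.\<close>
      fix z assume z: "z \<in> pm n"
      let ?x = "inv ?p z"
      have x: "?x \<in> pm n" using B_pm_iff[OF B_inv[OF piT_B[OF w]]] z by blast
      have px: "?p ?x = z" using piT_B[OF w] by simp
      have Pz: "PopT n w z = w ?x" using PopT_piT[OF w, of ?x] px by simp
      have wx: "w ?x \<in> pm n" using B_pm_iff[OF w] x by blast
      show "cdist n z (PopT n w z) \<le> int n"
      proof (cases "w ?x = ?x")
        case True
        then have "z = ?x" using px piT_fixpoint_iff[OF w] by metis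
        then show ?thesis using half[OF x] Pz by simp
      next
        case False
        then have "cdist n ?x z \<le> cdist n ?x (w ?x)" "0 < cdist n ?x z"
          using next_in_props(3,4)[OF R ncl_step[OF x] False] px pe by simp_all
        then show ?thesis using cdist_base[OF x z wx] half[OF x] Pz by simp
      qed
    qed
    ultimately show ?thesis using slow_step[OF w False] by blast
  qed (simp add: slow_id)
qed

section \<open>Elements with few non-antiexceedances\<close>

lemma cdist_cox_funpow:
  "x \<in> pm n \<Longrightarrow> y \<in> pm n \<Longrightarrow> cdist n x y + int k < 2 * int n \<Longrightarrow>
    (cox n ^^ k) y \<in> pm n \<and> cdist n x ((cox n ^^ k) y) = cdist n x y + int k"
proof (induction k)
  case (Suc k)
  then show ?case using cdist_cox[of x n "(cox n ^^ k) y"] cox_pm by simp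
qed simp

text \<open>Whenever \<open>piT\<close> is \<open>cox n\<close>, one application of Pop raises the
  exponent by one. At exponent n the map moves each point forward by at least n and less than 2n, so
  its inverse moves points by at most n and \<open>slow_half_turn\<close> applies. Hypothesis
  \<open>adj\<close> says that \<open>u\<close> never jumps over a moved neighbour.\<close>

lemma slow_rotations:
  assumes u: "u \<in> B n" and gap: "\<And>x. x \<in> pm n \<Longrightarrow> cdist n x (u x) < int n"
    and adj: "\<And>x. x \<in> pm n \<Longrightarrow> u (cox n x) \<noteq> cox n x \<Longrightarrow> u x = x \<or> u x = cox n x"
    and k: "1 \<le> k" "k \<le> n"
  shows "slow n (inv ((cox n ^^ k) \<circ> u))"
  using k
proof (induction "n - k" arbitrary: k)
  case 0
  then have "k = n" by simp
  show ?case
  proof (rule slow_half_turn)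
    show "inv ((cox n ^^ k) \<circ> u) \<in> B n" by (intro B_inv B_comp B_funpow cox_B u)
    fix x assume x: "x \<in> pm n"
    let ?v = "(cox n ^^ k) \<circ> u"
    have v: "?v \<in> B n" by (intro B_comp B_funpow cox_B u)
    let ?y = "inv ?v x"
    have y: "?y \<in> pm n" using B_pm_iff[OF B_inv[OF v]] x by blast
    have uy: "u ?y \<in> pm n" using B_pm_iff[OF u] y by blast
    have "x = ?v ?y" by (rule B_inv_apply(2)[OF v, of x, symmetric])
    then have "x = (cox n ^^ k) (u ?y)" by (simp only: comp_apply)
    then have "cdist n ?y x = cdist n ?y (u ?y) + int n"
      using cdist_cox_funpow[OF y uy, of k] gap[OF y] \<open>k = n\<close> by simp
    then show "cdist n x ?y \<le> int n"
      using cdist_base[OF y x y] cdist_nonneg[OF y uy] x by (auto simp: pm_def)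
  qed
next
  case (Suc m)
  let ?v = "(cox n ^^ k) \<circ> u"
  have v: "?v \<in> B n" by (intro B_comp B_funpow cox_B u)
  have w: "inv ?v \<in> B n" using B_inv[OF v] .
  have kn: "1 \<le> k" "k < n" using Suc by auto
  let ?R = "ncl n (inv ?v)"
  note R = ncl_ncrel[OF w]
  have vR: "?R y (?v y)" if "y \<in> pm n" for y
  proof -
    have "?R (?v y) (inv ?v (?v y))" using that B_pm_iff[OF v] by (intro ncl_step) blast
    then show ?thesis using ncrel_sym[OF R] B_inv_apply(1)[OF v] by metis
  qed
  have vd: "cdist n y (?v y) = cdist n y (u y) + int k" "?v y \<in> pm n" if "y \<in> pm n" for y
    using cdist_cox_funpow[OF that, of "u y" k] gap[OF that] B_pm_iff[OF u] that kn by auto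
  have central: "?R x (- x)" if x: "x \<in> pm n" for x
  proof (rule ccontr)
    assume "\<not> ?R x (- x)"
    then obtain a where a: "?R x a" "\<And>z. ?R x z \<Longrightarrow> cdist n a z < int n"
      using ncrel_first[OF R x] by blast
    have apm: "a \<in> pm n" using ncrel_pm[OF R a(1)] by blast
    have Ra: "cdist n a z < int n" if "?R a z" for z using a(2) ncrel_trans[OF R a(1) that] .
    have fin: "finite {z. ?R a z}"
      using ncrel_pm(2)[OF R] by (intro finite_subset[OF _ finite_pm[of n]]) auto
    have "Max (cdist n a ` {z. ?R a z}) \<in> cdist n a ` {z. ?R a z}"
      using fin ncrel_refl[OF R apm] by (intro Max_in) auto
    then obtain y where "?R a y" "Max (cdist n a ` {z. ?R a z}) = cdist n a y" by blast
    then have y: "?R a y" "\<And>z. ?R a z \<Longrightarrow> cdist n a z \<le> cdist n a y"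
      using Max_ge[OF finite_imageI[OF fin], of _ "cdist n a"] by auto
    define D where "D = cdist n a y"
    have ypm: "y \<in> pm n" using ncrel_pm[OF R y(1)] by blast
    have vy: "?R a (?v y)" using ncrel_trans[OF R y(1) vR[OF ypm]] .
    have uy: "u y \<in> pm n" using B_pm_iff[OF u] ypm by blast
    have "0 < cdist n y (?v y)" using vd(1)[OF ypm] cdist_nonneg[OF ypm uy] kn by simp
    \<comment> \<open>\<open>y\<close> is the last point of the class counted from \<open>a\<close>,
      and \<open>?v y\<close> is in the class again, so the way from \<open>y\<close> to
      \<open>?v y\<close> must wrap around to \<open>a\<close> or beyond.\<close>
    then have far: "cdist n y (u y) + int k = cdist n a (?v y) - D + 2 * int n" "cdist n a (?v y) < D"
      using cdist_base[OF apm ypm vd(2)[OF ypm]] y(2)[OF vy] vd(1)[OF ypm] unfolding D_def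
      by (auto split: if_splits)
    have D: "0 < D" "D < int n" using far(2) cdist_nonneg[OF apm vd(2)[OF ypm]] Ra[OF y(1)] unfolding D_def by auto
    have "0 < cdist n y (u y)" using far(1) cdist_nonneg[OF apm vd(2)[OF ypm]] D kn by simp
    then have unfix: "u y \<noteq> y" by auto
    \<comment> \<open>Getting from \<open>y\<close> back to \<open>a\<close> takes at least n + 1
      steps, of which \<open>u\<close> contributes at most n - 1.\<close>
    have k2: "2 \<le> k"
      using far(1) cdist_nonneg[OF apm vd(2)[OF ypm]] D gap[OF ypm] kn by simp
    let ?z = "inv (cox n) y"
    have zpm: "?z \<in> pm n" using B_pm_iff[OF B_inv[OF cox_B]] ypm by blast
    have cz: "cox n ?z = y" by (rule B_inv_apply(2)[OF cox_B])
    have zy: "cdist n ?z y = 1" using cdist_cox[OF zpm zpm] cz zpm by (auto simp: pm_def)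
    have az: "cdist n a ?z = D - 1"
      using cdist_cox[OF apm zpm] cz D unfolding D_def by (auto split: if_splits)
    have "cdist n ?z (u ?z) \<in> {0, 1}" using adj[OF zpm] cz unfix zy by auto
    then have vz: "cdist n ?z (?v ?z) \<in> {int k, int k + 1}" using vd(1)[OF zpm] by auto
    \<comment> \<open>\<open>?z\<close> is one step before \<open>y\<close>, and \<open>?v\<close>
      moves it by \<open>k\<close> or \<open>k + 1\<close>. This overshoots \<open>y\<close> as
      \<open>k\<close> is at least 2, and does not wrap around as \<open>k < n\<close>.\<close>
    have avz: "D < cdist n a (?v ?z)"
      using cdist_base[OF apm zpm vd(2)[OF zpm]] cdist_nonneg[OF apm vd(2)[OF zpm]] vz az k2 kn D
      by (auto split: if_splits)
    have "\<not> ?R a ?z"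
    proof
      assume "?R a ?z"
      then have "?R a (?v ?z)" using ncrel_trans[OF R, of a ?z "?v ?z"] vR[OF zpm] by blast
      then show False using y(2) avz unfolding D_def by force
    qed
    moreover from this have "0 < cdist n a ?z" using cdist_pos[OF apm zpm] ncrel_refl[OF R apm] by metis
    \<comment> \<open>The chords from \<open>a\<close> to \<open>y\<close> and from
      \<open>?z\<close> to \<open>?v ?z\<close> cross, which would put \<open>?z\<close> into the
      class of \<open>a\<close>.\<close>
    ultimately show False
      using ncrel_cross[OF R, of a y ?z "?v ?z"] y(1) vR[OF zpm] az avz unfolding D_def by simp
  qed
  have total: "?R x y" if "x \<in> pm n" "y \<in> pm n" for x y
    using ncrel_central[OF R central central] that by blast
  have cox1: "cdist n x (cox n x) = 1" if "x \<in> pm n" for x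
    using cdist_cox[OF that that] that by (auto simp: pm_def)
  have next1: "next_in n ?R x = cox n x" for x
  proof (cases "x \<in> pm n")
    case True
    show ?thesis
    proof (rule next_in_unique[OF R])
      show "?R x (cox n x)" using total[OF True cox_pm[OF True]] .
      show "cox n x \<noteq> x" using cox1[OF True] by auto
      show "cdist n x (cox n x) \<le> cdist n x z" if "?R x z" "z \<noteq> x" for z
        using cdist_pos[OF True, of z] ncrel_pm(2)[OF R that(1)] that(2) cox1[OF True] by simp
    qed
  qed (use next_in_outside[OF R] B_outside[OF cox_B] in simp)
  then have pi: "piT n (inv ?v) = cox n" using piT_eq[OF w] by auto
  have "PopT n (inv ?v) = inv ((cox n ^^ Suc k) \<circ> u)"
    unfolding PopT_def pi using B_inv_comp[OF cox_B v] by (simp add: o_assoc)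
  moreover have "slow n (inv ((cox n ^^ Suc k) \<circ> u))"
    using Suc.hyps(1)[of "Suc k"] Suc.hyps(2) kn by simp
  moreover have "cyc n (piT n (inv ?v)) = 1"
  proof -
    have "1 \<in> pm n" using kn by (simp add: pm_def)
    then have "\<exists>x\<in>pm n. next_in n ?R x \<noteq> x" using next1 cox1 by (metis cdist_self zero_neq_one)
    then show ?thesis using cyc_next_in_1[OF R] total piT_eq[OF w] by simp
  qed
  ultimately show ?case using slow_step[OF w] slow_id by (cases "inv ?v = id") auto
qed

lemma card_pm: "card (pm n) = 2 * n"
proof -
  have "pm n = {- int n..-1} \<union> {1..int n}" by (auto simp: pm_def)
  then show ?thesis by (simp add: card_Un_disjoint)
qed

text \<open>\<open>cox n\<close> raises the rank by one, except that it sends n to rank 1. So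
  \<open>i\<close> is moved to a larger rank by \<open>cox n \<circ> u\<close> iff it is no descent
  of \<open>u\<close> and \<open>u i\<close> is not n; the preimage of n accounts for the -
  1.\<close>

lemma card_desc_complement:
  assumes u: "u \<in> B n" and n: "1 \<le> n"
  shows "card (desc n (inv (cox n \<circ> u))) + card (desc n u) = 2 * n - 1"
proof -
  let ?v = "cox n \<circ> u"
  have v: "?v \<in> B n" by (intro B_comp cox_B u)
  let ?m = "inv u (int n)"
  have npm: "int n \<in> pm n" using n by (simp add: pm_def)
  have m: "?m \<in> pm n" "u ?m = int n" using B_pm_iff[OF B_inv[OF u]] npm u by simp_all
  let ?A = "{i \<in> pm n. rk n i < rk n (?v i)}"
  have "desc n (inv ?v) = ?v ` ?A"
  proof (intro equalityI subsetI)
    fix j assume "j \<in> desc n (inv ?v)"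
    then have "inv ?v j \<in> ?A" using B_pm_iff[OF B_inv[OF v]] B_inv_apply(2)[OF v, of j]
      by (simp add: desc_def)
    with B_inv_apply(2)[OF v, of j, symmetric] show "j \<in> ?v ` ?A" by (rule image_eqI)
  next
    fix j assume "j \<in> ?v ` ?A"
    then obtain i where "i \<in> ?A" "j = ?v i" by blast
    then show "j \<in> desc n (inv ?v)" using B_pm_iff[OF v, of i] B_inv_apply(1)[OF v, of i]
      by (simp add: desc_def)
  qed
  moreover have "inj_on ?v ?A" using B_eq_iff[OF v] by (simp add: inj_on_def)
  ultimately have 1: "card (desc n (inv ?v)) = card ?A" by (simp only: card_image)
  have "?A = pm n - desc n u - {?m}"
  proof -
    have "i \<in> ?A \<longleftrightarrow> i \<notin> desc n u \<and> i \<noteq> ?m" if i: "i \<in> pm n" for i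
    proof -
      have ui: "u i \<in> pm n" using B_pm_iff[OF u] i by blast
      have "rk n (int n) = 2 * int n" using n by (simp add: rk_def)
      then have "rk n (u i) = 2 * int n \<longleftrightarrow> i = ?m"
        using rk_inj[OF ui npm] B_eq_iff[OF u, of i ?m] m(2) by metis
      then show ?thesis using rk_cox[OF ui] rk_bounds[OF i] i by (auto simp: desc_def)
    qed
    then show ?thesis by (auto simp: desc_def)
  qed
  moreover have "?m \<notin> desc n u" using m rk_bounds[OF m(1)] n by (simp add: desc_def rk_def)
  moreover have "desc n u \<subseteq> pm n" by (auto simp: desc_def)
  ultimately have "card ?A = 2 * n - card (desc n u) - 1"
    using m(1) by (simp add: card_Diff_subset card_pm)
  moreover have "card (desc n u) < 2 * n"
    using psubset_card_mono[OF finite_pm[of n], of "desc n u"] \<open>?m \<notin> desc n u\<close> m(1) \<open>desc n u \<subseteq> pm n\<close>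
    by (metis card_pm psubsetI)
  ultimately show ?thesis using 1 by simp
qed

section \<open>Cycles through centrally symmetric sets\<close>

definition block :: "nat \<Rightarrow> int set \<Rightarrow> int \<Rightarrow> int \<Rightarrow> bool" where
  "block n Z x y \<longleftrightarrow> x \<in> pm n \<and> y \<in> pm n \<and> (x = y \<or> x \<in> Z \<and> y \<in> Z)"

lemma block_ncrel: "(\<And>z. z \<in> Z \<Longrightarrow> - z \<in> Z) \<Longrightarrow> ncrel n (block n Z)"
  unfolding ncrel_def
proof (intro conjI allI ballI impI)
  fix a b c d
  assume "block n Z a c" "block n Z b d" "0 < cdist n a b" "cdist n a b < cdist n a c"
    "cdist n a c < cdist n a d"
  moreover from this have "a \<noteq> c" "b \<noteq> d" by auto
  ultimately show "block n Z a b" by (simp add: block_def)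
qed (auto simp: block_def)

text \<open>Indexing by the positive half of the support turns the final count into a count of
  subsets of \<open>{1..int n}\<close>.\<close>

definition zcycle :: "nat \<Rightarrow> int set \<Rightarrow> int \<Rightarrow> int" where
  "zcycle n A = next_in n (block n (A \<union> uminus ` A))"

context
  fixes n A
  assumes A: "A \<subseteq> {1..int n}"
begin

lemma zcycle_block_ncrel: "ncrel n (block n (A \<union> uminus ` A))"
  by (rule block_ncrel) auto

lemma zcycle_B: "zcycle n A \<in> B n"
  unfolding zcycle_def by (rule next_in_B[OF zcycle_block_ncrel])

lemma zcycle_nonfixed: "zcycle n A x \<noteq> x \<longleftrightarrow> x \<in> A \<union> uminus ` A"
proof
  assume "x \<in> A \<union> uminus ` A"
  then have "block n (A \<union> uminus ` A) x (- x)" "- x \<noteq> x" using A by (auto simp: block_def pm_def)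
  then show "zcycle n A x \<noteq> x"
    unfolding zcycle_def by (rule next_in_props(2)[OF zcycle_block_ncrel])
next
  assume "zcycle n A x \<noteq> x"
  then show "x \<in> A \<union> uminus ` A"
    unfolding zcycle_def using next_in_trivial[OF zcycle_block_ncrel, of x] by (auto simp: block_def)
qed

lemma zcycle_supp: "A = {x. 0 < x \<and> zcycle n A x \<noteq> x}"
  unfolding zcycle_nonfixed using A by (auto dest: subsetD)

lemma card_desc_zcycle: "A \<noteq> {} \<Longrightarrow> card (desc n (zcycle n A)) = 1"
proof -
  assume "A \<noteq> {}"
  then obtain a where "a \<in> A" by blast
  then have "\<exists>x\<in>pm n. zcycle n A x \<noteq> x" using A by (intro bexI[of _ a]) (auto simp: zcycle_nonfixed pm_def)
  moreover have "block n (A \<union> uminus ` A) x y"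
    if "x \<in> pm n" "y \<in> pm n" "zcycle n A x \<noteq> x" "zcycle n A y \<noteq> y" for x y
    using that unfolding zcycle_nonfixed by (simp add: block_def)
  ultimately have "cyc n (zcycle n A) = 1"
    using cyc_next_in_1[OF zcycle_block_ncrel] unfolding zcycle_def by blast
  then show ?thesis
    using card_desc_next_in[OF zcycle_block_ncrel] unfolding zcycle_def by simp
qed

lemma zcycle_next:
  assumes "x \<in> A \<union> uminus ` A" "y \<in> A \<union> uminus ` A" "y \<noteq> x"
  shows "cdist n x (zcycle n A x) \<le> cdist n x y"
proof -
  have "block n (A \<union> uminus ` A) x y" using assms A by (auto simp: block_def pm_def)
  then show ?thesis unfolding zcycle_def using next_in_props(3)[OF zcycle_block_ncrel] assms(3) by blast
qed

lemma zcycle_gap_le: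
  assumes x: "x \<in> pm n"
  shows "cdist n x (zcycle n A x) \<le> int n"
proof (cases "zcycle n A x = x")
  case False
  then have "x \<in> A \<union> uminus ` A" by (simp add: zcycle_nonfixed)
  then have "cdist n x (zcycle n A x) \<le> cdist n x (- x)" using x by (intro zcycle_next) (auto simp: pm_def)
  then show ?thesis using cdist_minus_right[OF x x] x by (simp add: pm_def split: if_splits)
qed simp

text \<open>If the point after \<open>x\<close> is on the cycle, a moved \<open>x\<close> has no
  nearer successor. This supplies \<open>adj\<close> for \<open>slow_rotations\<close>.\<close>

lemma zcycle_adj:
  assumes x: "x \<in> pm n" and nf: "zcycle n A (cox n x) \<noteq> cox n x"
  shows "zcycle n A x = x \<or> zcycle n A x = cox n x"
proof (cases "zcycle n A x = x")
  case False
  have c1: "cdist n x (cox n x) = 1" using cdist_cox[OF x x] x by (auto simp: pm_def)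
  have zx: "zcycle n A x \<in> pm n" using B_pm_iff[OF zcycle_B] x by blast
  have "cdist n x (zcycle n A x) \<le> cdist n x (cox n x)"
    using False nf c1 by (intro zcycle_next) (auto simp: zcycle_nonfixed)
  moreover have "0 < cdist n x (zcycle n A x)" using cdist_pos[OF x zx] False by simp
  ultimately have "cdist n x (zcycle n A x) = cdist n x (cox n x)" using c1 by simp
  then show ?thesis using cdist_inj[OF x zx cox_pm[OF x]] by blast
qed simp

text \<open>Both the step from \<open>i\<close> to \<open>- i\<close> and the step back are half
  turns, so neither open half circle contains a point of the support.\<close>

lemma zcycle_antipodal:
  assumes i: "i \<in> pm n" "zcycle n A i = - i"
  shows "A \<union> uminus ` A = {i, - i}"
proof -
  have iZ: "i \<in> A \<union> uminus ` A" "- i \<in> A \<union> uminus ` A"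
    using i zcycle_nonfixed[of i] by (auto simp: pm_def)
  have zi: "zcycle n A (- i) = i" using B_minus[OF zcycle_B, of i] i(2) by simp
  have mi: "- i \<in> pm n" using i by simp
  have half: "cdist n i (- i) = int n" "cdist n (- i) i = int n"
    using cdist_minus_right[OF i(1) i(1)] cdist_minus_right[OF mi mi] i by (auto simp: pm_def)
  have "y = i \<or> y = - i" if y: "y \<in> A \<union> uminus ` A" for y
  proof (rule ccontr)
    assume ne: "\<not> (y = i \<or> y = - i)"
    have ypm: "y \<in> pm n" using y A by (auto simp: pm_def)
    have "int n \<le> cdist n i y" using zcycle_next[OF iZ(1) y] ne half i by simp
    moreover have "int n \<le> cdist n (- i) y" using zcycle_next[OF iZ(2) y] ne half zi by simp
    ultimately show False using cdist_base[OF i(1) mi ypm] half cdist_less[OF i(1) ypm] by simp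
  qed
  then show ?thesis using iZ by blast
qed

lemma slow_zcycle:
  assumes n: "1 \<le> n" and na: "\<And>i. i \<in> pm n \<Longrightarrow> zcycle n A i \<noteq> - i"
  shows "slow n (inv (cox n \<circ> zcycle n A))"
proof -
  have "cdist n x (zcycle n A x) < int n" if x: "x \<in> pm n" for x
  proof -
    have zx: "zcycle n A x \<in> pm n" using B_pm_iff[OF zcycle_B] x by blast
    have "cdist n x (- x) = int n" using cdist_minus_right[OF x x] x by (auto simp: pm_def)
    then have "cdist n x (zcycle n A x) \<noteq> int n"
      using cdist_inj[OF x zx, of "- x"] x na[OF x] by auto
    then show ?thesis using zcycle_gap_le[OF x] by simp
  qed
  from slow_rotations[OF zcycle_B this zcycle_adj, of 1] n show ?thesis by simp
qed

text \<open>If \<open>zcycle n A\<close> exchanges \<open>i\<close> and \<open>-i\<close>, then \<open>cox n \<circ> zcycle n A\<close> preserves the two half circles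
  bounded by \<open>i\<close> and \<open>-i\<close>, and so no class is centrally symmetric.\<close>

lemma cyc_antipodal:
  assumes i: "i \<in> pm n" "zcycle n A i = - i"
  shows "cyc n (piT n (inv (cox n \<circ> zcycle n A))) \<noteq> 1"
proof
  let ?v = "cox n \<circ> zcycle n A"
  have v: "?v \<in> B n" by (intro B_comp cox_B zcycle_B)
  note w = B_inv[OF v]
  note R = ncl_ncrel[OF w]
  \<comment> \<open>The half circle contains \<open>- i\<close> but not \<open>i\<close>, so that
    negation exchanges it with its complement.\<close>
  let ?H = "\<lambda>x. 0 < cdist n i x \<and> cdist n i x \<le> int n"
  let ?S = "\<lambda>x y. x \<in> pm n \<and> y \<in> pm n \<and> (?H x \<longleftrightarrow> ?H y)"
  have mH: "?H (- x) \<longleftrightarrow> \<not> ?H x" if x: "x \<in> pm n" for x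
    using cdist_minus_right[OF i(1) x] cdist_nonneg[OF i(1) x] cdist_less[OF i(1) x] by auto
  have "ncrel n ?S"
    unfolding ncrel_def
  proof (intro conjI allI ballI impI)
    fix a b c d
    assume *: "?S a c" "?S b d" "0 < cdist n a b" "cdist n a b < cdist n a c" "cdist n a c < cdist n a d"
    then have pm: "a \<in> pm n" "b \<in> pm n" "c \<in> pm n" "d \<in> pm n" by auto
    note nonneg = pm[THEN cdist_nonneg[OF i(1)]]
    show "?H a \<longleftrightarrow> ?H b"
      using * nonneg cdist_base[OF i(1) pm(1) pm(2)] cdist_base[OF i(1) pm(1) pm(3)]
        cdist_base[OF i(1) pm(1) pm(4)] pm[THEN cdist_less[OF i(1)]]
      by (auto split: if_splits)
  qed (use mH in auto)
  moreover have vH: "?S x (?v x)" if x: "x \<in> pm n" for x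
  proof -
    have vx: "?v x \<in> pm n" using B_pm_iff[OF v] x by blast
    have zx: "zcycle n A x \<in> pm n" using B_pm_iff[OF zcycle_B] x by blast
    have mi: "- i \<in> pm n" "cdist n i (- i) = int n"
      using i(1) cdist_minus_right[OF i(1) i(1)] by (auto simp: pm_def)
    have "zcycle n A (- i) = i" using B_minus[OF zcycle_B, of i] i(2) by simp
    \<comment> \<open>\<open>cox n\<close> changes sides only at \<open>i\<close> and
      \<open>- i\<close>, and \<open>zcycle n A\<close> exchanges exactly these two points
      beforehand.\<close>
    then consider "x = i" "zcycle n A x = - i" | "x = - i" "zcycle n A x = i"
      | "x \<noteq> i" "x \<noteq> - i" "zcycle n A x = x"
    proof (cases "x = i \<or> x = - i")
      case False
      then have "x \<notin> A \<union> uminus ` A" unfolding zcycle_antipodal[OF i] by simp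
      then show ?thesis using that(3) False zcycle_nonfixed[of x] by blast
    qed (use that(1,2) i(2) in blast)
    then have "?H x \<longleftrightarrow> ?H (?v x)"
    proof cases
      case 1
      then show ?thesis using cdist_cox[OF i(1) mi(1)] mi(2) i(1) by (auto simp: pm_def)
    next
      case 2
      then show ?thesis using cdist_cox[OF i(1) i(1)] mi i(1) by (auto simp: pm_def)
    next
      case 3
      then have "cdist n i x \<noteq> int n" "cdist n i x \<noteq> 0"
        using cdist_inj[OF i(1) x mi(1)] mi(2) cdist_eq_0[OF i(1) x] by auto
      then show ?thesis using 3 cdist_cox[OF i(1) x] cdist_nonneg[OF i(1) x] cdist_less[OF i(1) x] by auto
    qed
    then show ?thesis using x vx by blast
  qed
  moreover have "?S x (inv ?v x)" if x: "x \<in> pm n" for x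
    using vH[of "inv ?v x"] x B_pm_iff[OF w, of x] B_inv_apply(2)[OF v, of x] by simp
  ultimately have sub: "?S x y" if "ncl n (inv ?v) x y" for x y using ncl_least[OF that] by blast
  assume "cyc n (piT n (inv ?v)) = 1"
  then have "\<exists>x\<in>pm n. next_in n (ncl n (inv ?v)) x \<noteq> x"
    and all: "\<And>x y. x \<in> pm n \<Longrightarrow> y \<in> pm n \<Longrightarrow> next_in n (ncl n (inv ?v)) x \<noteq> x \<Longrightarrow>
      next_in n (ncl n (inv ?v)) y \<noteq> y \<Longrightarrow> ncl n (inv ?v) x y"
    unfolding piT_eq[OF w] cyc_next_in_1[OF R] by blast+
  then obtain x where x: "x \<in> pm n" "next_in n (ncl n (inv ?v)) x \<noteq> x" by blast
  then have "ncl n (inv ?v) x (- x)" using all[of x "- x"] next_in_minus[OF R, of x] by simp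
  then show False using sub mH[OF x(1)] by blast
qed

end

text \<open>For \<open>u\<close> other than the identity, Pop removes at least one descent and hence
  all, so \<open>PopT n u = id\<close> and \<open>u = piT n u\<close>. The loss being exactly one,
  the moved points form a single class.\<close>

lemma single_descent:
  assumes u: "u \<in> B n" and d: "card (desc n u) \<le> 1"
  obtains A where "A \<subseteq> {1..int n}" "u = zcycle n A"
proof
  let ?A = "{x. 0 < x \<and> u x \<noteq> x}" and ?R = "ncl n u"
  note R = ncl_ncrel[OF u]
  show "?A \<subseteq> {1..int n}" using B_outside[OF u] by (force simp: pm_def)
  have Z: "x \<in> ?A \<union> uminus ` ?A \<longleftrightarrow> u x \<noteq> x" for x
  proof -
    have "u x \<noteq> x \<longleftrightarrow> u (- x) \<noteq> - x" using B_minus[OF u, of x] by auto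
    moreover have "u 0 = 0" using B_outside[OF u, of 0] by (simp add: pm_def)
    moreover have "x \<in> uminus ` ?A \<longleftrightarrow> - x \<in> ?A" by (metis (no_types, lifting) image_iff minus_minus)
    ultimately show ?thesis by (cases x "0::int" rule: linorder_cases) auto
  qed
  have "?R = block n (?A \<union> uminus ` ?A)"
  proof (cases "u = id")
    case True
    then have ux: "u x = x" for x by simp
    have "?R x y \<longleftrightarrow> x \<in> pm n \<and> x = y" for x y
      using ncl_fixpoint[OF ux u, of x y] ncl_pm[OF u, of x y] ncrel_refl[OF R, of x] by auto
    then have "?R x y \<longleftrightarrow> block n (?A \<union> uminus ` ?A) x y" for x y
      unfolding block_def Z using ux by auto
    then show ?thesis by (simp add: fun_eq_iff)
  next
    case False
    have "cyc n (piT n u) = 1" using card_desc_PopT[OF u] cyc_pos[OF u False] d by linarith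
    then have all: "?R x y" if "u x \<noteq> x" "u y \<noteq> y" "x \<in> pm n" "y \<in> pm n" for x y
      using that cyc_next_in_1[OF R] piT_fixpoint_iff[OF u] unfolding piT_eq[OF u] by blast
    have "?R x y \<longleftrightarrow> block n (?A \<union> uminus ` ?A) x y" for x y
    proof
      assume xy: "?R x y"
      have "u x \<noteq> x \<and> u y \<noteq> y" if "x \<noteq> y"
        using ncl_fixpoint[OF _ u xy] ncl_fixpoint[OF _ u ncrel_sym[OF R xy]] that by blast
      then show "block n (?A \<union> uminus ` ?A) x y" unfolding block_def Z using ncrel_pm[OF R xy] by blast
    next
      assume "block n (?A \<union> uminus ` ?A) x y"
      then show "?R x y" unfolding block_def Z using all ncrel_refl[OF R] by blast
    qed
    then show ?thesis by (simp add: fun_eq_iff)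
  qed
  moreover have "u = piT n u"
  proof -
    have "desc n (PopT n u) = {}"
    proof (cases "u = id")
      case False
      have "card (desc n (PopT n u)) = 0" using card_desc_PopT[OF u] cyc_pos[OF u False] d by linarith
      then show ?thesis by simp
    qed (simp add: PopT_id desc_def)
    then have "PopT n u = id" using desc_empty[OF PopT_B[OF u]] by blast
    then show ?thesis using PopT_piT[OF u] by (auto simp: fun_eq_iff)
  qed
  ultimately show "u = zcycle n ?A" unfolding zcycle_def using piT_eq[OF u] by simp
qed

lemma zcycle_empty: "zcycle n {} = id"
proof
  show "zcycle n {} x = id x" for x using zcycle_nonfixed[of "{}" n x] by simp
qed

text \<open>Solves \<open>w = inv (cox n \<circ> u)\<close> for \<open>u\<close>.\<close>

lemma cox_inv_cancel:
  assumes w: "w \<in> B n"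
  shows "inv (cox n \<circ> inv (w \<circ> cox n)) = w" "inv (w \<circ> cox n) \<in> B n"
proof -
  show 1: "inv (w \<circ> cox n) \<in> B n" using w by (intro B_inv B_comp cox_B)
  have "inv (cox n \<circ> inv (w \<circ> cox n)) = inv (inv (w \<circ> cox n)) \<circ> inv (cox n)"
    by (rule B_inv_comp[OF cox_B 1])
  also have "\<dots> = w \<circ> (cox n \<circ> inv (cox n))" using B_inv_inv[OF B_comp[OF w cox_B]] by (simp add: o_assoc)
  finally show "inv (cox n \<circ> inv (w \<circ> cox n)) = w" using B_inv_o(2)[OF cox_B] by simp
qed

text \<open>A singleton \<open>{a}\<close> gives the exchange of \<open>a\<close> and
  \<open>- a\<close>, and only singletons have an antipodal pair. The empty set has none either and
  is excluded separately.\<close>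

lemma zcycle_no_antipodal_iff:
  assumes A: "A \<subseteq> {1..int n}"
  shows "A \<noteq> {} \<and> (\<forall>i\<in>pm n. zcycle n A i \<noteq> - i) \<longleftrightarrow> 2 \<le> card A"
proof -
  have fin: "finite A" using A finite_subset by blast
  show ?thesis
  proof
    assume *: "A \<noteq> {} \<and> (\<forall>i\<in>pm n. zcycle n A i \<noteq> - i)"
    show "2 \<le> card A"
    proof (rule ccontr)
      assume "\<not> 2 \<le> card A"
      moreover have "card A \<noteq> 0" using * fin by simp
      ultimately have "card A = 1" by simp
      then obtain a where a: "A = {a}" by (rule card_1_singletonE)
      then have apm: "a \<in> pm n" using A by (auto simp: pm_def)
      have nf: "zcycle n A a \<noteq> a" using zcycle_nonfixed[OF A] a by simp
      then have "zcycle n A (zcycle n A a) \<noteq> zcycle n A a" using B_eq_iff[OF zcycle_B[OF A]] by simp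
      then have "zcycle n A a \<in> A \<union> uminus ` A" using zcycle_nonfixed[OF A, of "zcycle n A a"] by blast
      moreover have "A \<union> uminus ` A = {a, - a}" using a by auto
      ultimately have "zcycle n A a \<in> {a, - a}" by simp
      then show False using nf * apm by auto
    qed
  next
    assume c: "2 \<le> card A"
    have "zcycle n A i \<noteq> - i" if i: "i \<in> pm n" for i
    proof
      assume "zcycle n A i = - i"
      then have "A \<subseteq> {i, - i}" using zcycle_antipodal[OF A i] by blast
      then have "A \<subseteq> {\<bar>i\<bar>}" using A by (auto simp: abs_if)
      then show False using c card_mono[of "{\<bar>i\<bar>}" A] by simp
    qed
    then show "A \<noteq> {} \<and> (\<forall>i\<in>pm n. zcycle n A i \<noteq> - i)" using c by auto
  qed
qed

text \<open>For empty \<open>A\<close> there are 2n - 1 antiexceedances and the orbit has 2n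
  elements. A singleton gives 2n - 2 antiexceedances, but its first Pop step loses at least two of
  them. Larger sets give 2n - 2 antiexceedances and a slow orbit.\<close>

lemma orbit_zcycle:
  assumes n: "2 \<le> n" and A: "A \<subseteq> {1..int n}" and w: "w = inv (cox n \<circ> zcycle n A)"
  shows "card (orbitPop n w) = 2 * n - 1 \<longleftrightarrow> 2 \<le> card A"
    and "B_splittable n w \<longleftrightarrow> 2 \<le> card A"
proof -
  have wB: "w \<in> B n" unfolding w by (intro B_inv B_comp cox_B zcycle_B[OF A])
  have sum: "card (desc n w) + card (desc n (zcycle n A)) = 2 * n - 1"
    unfolding w using card_desc_complement[OF zcycle_B[OF A]] n by simp
  have slow: "slow n w" if "\<forall>i\<in>pm n. zcycle n A i \<noteq> - i"
    unfolding w using slow_zcycle[OF A] n that by simp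
  have "(card (orbitPop n w) = 2 * n - 1 \<longleftrightarrow> 2 \<le> card A) \<and> (B_splittable n w \<longleftrightarrow> 2 \<le> card A)"
  proof (cases "A = {}")
    case True
    then have "card (desc n w) = 2 * n - 1" using sum by (simp add: zcycle_empty desc_def)
    moreover have "zcycle n A i \<noteq> - i" if "i \<in> pm n" for i
      using True that by (auto simp: zcycle_empty pm_def)
    then have "slow n w" using slow by blast
    ultimately show ?thesis
      using True n card_antiexc[OF wB] by (auto simp: slow_def B_splittable_def)
  next
    case False
    then have d: "card (desc n w) = 2 * n - 2" using sum card_desc_zcycle[OF A] by simp
    then have "w \<noteq> id" using n by (auto simp: desc_def)
    note step = slow_step[OF wB this]
    have "slow n w \<longleftrightarrow> (\<forall>i\<in>pm n. zcycle n A i \<noteq> - i)"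
      using slow step cyc_antipodal[OF A] w by blast
    moreover have "cyc n (piT n w) = 1 \<longleftrightarrow> (\<forall>i\<in>pm n. zcycle n A i \<noteq> - i)"
      using slow step cyc_antipodal[OF A] w by blast
    ultimately show ?thesis
      using d n card_antiexc[OF wB] False zcycle_no_antipodal_iff[OF A]
      by (auto simp: slow_def B_splittable_def)
  qed
  then show "card (orbitPop n w) = 2 * n - 1 \<longleftrightarrow> 2 \<le> card A" "B_splittable n w \<longleftrightarrow> 2 \<le> card A"
    by blast+
qed

lemma zcycle_if_many_antiexc:
  assumes n: "2 \<le> n" and w: "w \<in> B n" and d: "2 * n - 2 \<le> card (desc n w)"
  obtains A where "A \<subseteq> {1..int n}" "w = inv (cox n \<circ> zcycle n A)"
proof -
  let ?u = "inv (w \<circ> cox n)"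
  note u = cox_inv_cancel[OF w]
  have "card (desc n ?u) \<le> 1" using card_desc_complement[OF u(2)] n d unfolding u(1) by simp
  then obtain A where "A \<subseteq> {1..int n}" "?u = zcycle n A" using single_descent[OF u(2)] by blast
  then show ?thesis using that u(1) by metis
qed

section \<open>Counting the elements by subsets\<close>

lemma card_subsets_ge_2:
  assumes "finite S"
  shows "card {A. A \<subseteq> S \<and> 2 \<le> card A} = 2 ^ card S - card S - 1"
proof -
  have eq: "{A. A \<subseteq> S \<and> 2 \<le> card A} = Pow S - insert {} ((\<lambda>x. {x}) ` S)"
  proof (intro set_eqI)
    fix A
    have "2 \<le> card A \<longleftrightarrow> A \<noteq> {} \<and> (\<forall>x. A \<noteq> {x})" if "A \<subseteq> S"
    proof -
      have "finite A" using that assms finite_subset by blast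
      then have "card A = 0 \<longleftrightarrow> A = {}" by simp
      moreover have "card A = 1 \<longleftrightarrow> (\<exists>x. A = {x})" by (auto simp: card_1_singleton_iff)
      ultimately show ?thesis by (metis One_nat_def Suc_1 not_less_eq_eq le_Suc_eq le_zero_eq nat_le_linear)
    qed
    then show "A \<in> {A. A \<subseteq> S \<and> 2 \<le> card A} \<longleftrightarrow> A \<in> Pow S - insert {} ((\<lambda>x. {x}) ` S)" by auto
  qed
  have "card (insert {} ((\<lambda>x. {x}) ` S)) = Suc (card S)"
    using assms by (subst card_insert_disjoint) (auto simp: card_image)
  then show ?thesis
    unfolding eq using assms by (subst card_Diff_subset) (auto simp: card_Pow)
qed

theorem mainTheorem4:
  fixes n :: nat
  assumes "n \<ge> 2"
  shows "(\<forall>w \<in> B n. card (orbitPop n w) = 2 * n - 1 \<longleftrightarrow> B_splittable n w)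
       \<and> card {w \<in> B n. card (orbitPop n w) = 2 * n - 1} = 2 ^ n - n - 1"
proof
  have ex: "\<exists>A. A \<subseteq> {1..int n} \<and> w = inv (cox n \<circ> zcycle n A)"
    if w: "w \<in> B n" and "card (orbitPop n w) = 2 * n - 1 \<or> B_splittable n w" for w
  proof -
    \<comment> \<open>An orbit of 2n - 1 elements takes 2n - 2 steps that each lose a descent;
      splittability prescribes this number directly.\<close>
    have "2 * n - 2 \<le> card (desc n w)"
      using that card_orbitPop_le[OF w] card_antiexc[OF w] by (auto simp: B_splittable_def)
    then show ?thesis using zcycle_if_many_antiexc[OF assms w] by blast
  qed
  show "\<forall>w \<in> B n. card (orbitPop n w) = 2 * n - 1 \<longleftrightarrow> B_splittable n w"
    using ex orbit_zcycle[OF assms] by blast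
  let ?f = "\<lambda>A. inv (cox n \<circ> zcycle n A)" and ?T = "{A. A \<subseteq> {1..int n} \<and> 2 \<le> card A}"
  have f_B: "?f A \<in> B n" if "A \<subseteq> {1..int n}" for A
    by (intro B_inv B_comp cox_B zcycle_B[OF that])
  have "{w \<in> B n. card (orbitPop n w) = 2 * n - 1} = ?f ` ?T"
  proof (intro equalityI subsetI)
    fix w assume "w \<in> {w \<in> B n. card (orbitPop n w) = 2 * n - 1}"
    then have w: "w \<in> B n" "card (orbitPop n w) = 2 * n - 1" by auto
    then obtain A where A: "A \<subseteq> {1..int n}" "w = ?f A" using ex by blast
    then show "w \<in> ?f ` ?T" using orbit_zcycle(1)[OF assms A] w(2) by blast
  next
    fix w assume "w \<in> ?f ` ?T"
    then obtain A where A: "A \<subseteq> {1..int n}" "2 \<le> card A" "w = ?f A" by blast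
    then show "w \<in> {w \<in> B n. card (orbitPop n w) = 2 * n - 1}"
      using orbit_zcycle(1)[OF assms A(1,3)] f_B by simp
  qed
  \<comment> \<open>Cancelling the inverse and \<open>cox n\<close> leaves the cycle, whose positive
    moved points are \<open>A\<close>.\<close>
  moreover have "inj_on ?f ?T"
  proof (rule inj_onI)
    fix A A' assume "A \<in> ?T" "A' \<in> ?T" and eq: "?f A = ?f A'"
    then have A: "A \<subseteq> {1..int n}" "A' \<subseteq> {1..int n}" by auto
    have "cox n \<circ> zcycle n A = cox n \<circ> zcycle n A'"
      using arg_cong[OF eq, of inv] B_inv_inv B_comp[OF cox_B zcycle_B] A by metis
    then have "zcycle n A x = zcycle n A' x" for x
      using B_eq_iff[OF cox_B] by (metis comp_apply)
    then show "A = A'" using zcycle_supp[OF A(1)] zcycle_supp[OF A(2)] by simp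
  qed
  ultimately have "card {w \<in> B n. card (orbitPop n w) = 2 * n - 1} = card ?T" by (simp add: card_image)
  then show "card {w \<in> B n. card (orbitPop n w) = 2 * n - 1} = 2 ^ n - n - 1"
    using card_subsets_ge_2[of "{1..int n}"] by simp
qed

end
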